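(* Fix integers $q,N\ge1$ and $t>0$. For a probability law $\sigma$ on $\mathbb R^q$ with $\int\log(1+\|y\|^2)\,\sigma(\mathrm dy)<\infty$, put $$F_{q,N,t}(\sigma)=\frac1q\,\mathbb E\log\det\left(I+\frac1{Nt}\sum_{j=1}^Ny_jy_j^{\mathsf T}\right),\qquad y_1,\dots,y_N\ \text{i.i.d.}\sim\sigma.$$ Then $F_{q,N,t}$ is finite and concave in $\sigma$: for two such laws $\sigma_0,\sigma_1$ and $u\in[0,1]$, $F_{q,N,t}((1-u)\sigma_0+u\sigma_1)\ge(1-u)F_{q,N,t}(\sigma_0)+uF_{q,N,t}(\sigma_1)$. If $\sigma^\circ$ is the law of $Oy$, where $y\sim\sigma$ and $O$ is an independent Haar-distributed $q\times q$ orthogonal matrix, then $$F_{q,N,t}(\sigma)\le F_{q,N,t}(\sigma^\circ).$$ The same concavity inequality holds for general probability mixtures of laws whenever the mixture has a finite logarithmic moment: if $\sigma=\int\sigma_\theta\,\pi(\mathrm d\theta)$ for a probability measure $\pi$ and a measurable family of probability laws $(\sigma_\theta)$ on $\mathbb R^q$, and $\int\log(1+\|y\|^2)\,\sigma(\mathrm dy)<\infty$, then $F_{q,N,t}(\sigma)\ge\int F_{q,N,t}(\sigma_\theta)\,\pi(\mathrm d\theta)$. *)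

theory Defs
  imports "HOL-Probability.Probability"
begin

text \<open>Borel probability laws on \<open>\<real>\<^sup>q\<close> (with \<open>q = CARD('q)\<close>) that have a finite logarithmic moment.
  Note that \<open>space (prob_algebra borel)\<close> consists of the probability measures on the Borel sets.\<close>

definition log_moment_laws :: "(real^'q) measure set" where
  "log_moment_laws =
     {\<sigma> \<in> space (prob_algebra borel). integrable \<sigma> (\<lambda>y. ln (1 + (norm y)\<^sup>2))}"

definition outer_square :: "real^'q \<Rightarrow> real^'q^'q" where
  "outer_square y = columnvector y ** (transpose (columnvector y) :: real^'q^1)"

definition log_det_sample :: "nat \<Rightarrow> real \<Rightarrow> (nat \<Rightarrow> real^'q) \<Rightarrow> real" where
  "log_det_sample N t ys =
     ln (det (mat 1 + (1 / (real N * t)) *\<^sub>R (\<Sum>j\<in>{1..N}. outer_square (ys j))))"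

abbreviation iid_law :: "nat \<Rightarrow> 'a measure \<Rightarrow> (nat \<Rightarrow> 'a) measure" where
  "iid_law N \<sigma> \<equiv> PiM {1..N} (\<lambda>_. \<sigma>)"

text \<open>The expectation is a Bochner integral, so the value is meaningful only when
  \<open>log_det_sample N t\<close> is integrable with respect to \<open>iid_law N \<sigma>\<close>.\<close>

definition F :: "nat \<Rightarrow> real \<Rightarrow> (real^'q) measure \<Rightarrow> real" where
  "F N t \<sigma> = (1 / real CARD('q)) * (\<integral>ys. log_det_sample N t ys \<partial>iid_law N \<sigma>)"

text \<open>The measure \<open>(1 - u) \<sigma>\<^sub>0 + u \<sigma>\<^sub>1\<close>; \<open>emeasure_mix_law\<close> below states that it has these values.\<close>

definition mix_law :: "real \<Rightarrow> 'a measure \<Rightarrow> 'a measure \<Rightarrow> 'a measure" where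
  "mix_law u \<sigma>\<^sub>0 \<sigma>\<^sub>1 = measure_of (space \<sigma>\<^sub>0) (sets \<sigma>\<^sub>0)
     (\<lambda>A. ennreal (1 - u) * emeasure \<sigma>\<^sub>0 A + ennreal u * emeasure \<sigma>\<^sub>1 A)"

lemma sets_mix_law [simp]: "sets (mix_law u \<sigma>\<^sub>0 \<sigma>\<^sub>1) = sets \<sigma>\<^sub>0"
  by (simp add: mix_law_def)

lemma emeasure_mix_law:
  assumes "sets \<sigma>\<^sub>1 = sets \<sigma>\<^sub>0" "A \<in> sets \<sigma>\<^sub>0"
  shows "emeasure (mix_law u \<sigma>\<^sub>0 \<sigma>\<^sub>1) A =
    ennreal (1 - u) * emeasure \<sigma>\<^sub>0 A + ennreal u * emeasure \<sigma>\<^sub>1 A"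
proof (rule emeasure_measure_of[OF mix_law_def])
  show "countably_additive (sets (mix_law u \<sigma>\<^sub>0 \<sigma>\<^sub>1))
      (\<lambda>A. ennreal (1 - u) * emeasure \<sigma>\<^sub>0 A + ennreal u * emeasure \<sigma>\<^sub>1 A)"
  proof (rule countably_additiveI)
    fix B :: "nat \<Rightarrow> _"
    assume B: "range B \<subseteq> sets (mix_law u \<sigma>\<^sub>0 \<sigma>\<^sub>1)" "disjoint_family B"
    have "(\<Sum>i. emeasure \<sigma>\<^sub>0 (B i)) = emeasure \<sigma>\<^sub>0 (\<Union>i. B i)"
         "(\<Sum>i. emeasure \<sigma>\<^sub>1 (B i)) = emeasure \<sigma>\<^sub>1 (\<Union>i. B i)"
      using B assms(1) by (auto intro!: suminf_emeasure)
    then show "(\<Sum>i. ennreal (1 - u) * emeasure \<sigma>\<^sub>0 (B i) + ennreal u * emeasure \<sigma>\<^sub>1 (B i)) =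
        ennreal (1 - u) * emeasure \<sigma>\<^sub>0 (\<Union>i. B i) + ennreal u * emeasure \<sigma>\<^sub>1 (\<Union>i. B i)"
      by (simp add: suminf_add[symmetric] ennreal_suminf_cmult)
  qed
qed (use assms in \<open>auto simp: positive_def sets.space_closed\<close>)

text \<open>Normalised Haar measure on the compact group \<open>O(q)\<close>, as the left-invariant Borel probability
  measure on the subspace of orthogonal matrices.\<close>

definition haar_orthogonal :: "(real^'q^'q) measure \<Rightarrow> bool" where
  "haar_orthogonal H \<longleftrightarrow>
     H \<in> space (prob_algebra (restrict_space borel {Q. orthogonal_matrix Q})) \<and>
     (\<forall>Q. orthogonal_matrix Q \<longrightarrow> distr H H (\<lambda>R. Q ** R) = H)"

text \<open>The law of \<open>O y\<close>, where \<open>O\<close> has law \<open>H\<close>, \<open>y\<close> has law \<open>\<sigma>\<close>, and the two are independent.\<close>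

definition rotated_law :: "(real^'q^'q) measure \<Rightarrow> (real^'q) measure \<Rightarrow> (real^'q) measure" where
  "rotated_law H \<sigma> = distr (H \<Otimes>\<^sub>M \<sigma>) borel (\<lambda>(Q, y). Q *v y)"

end

theory Submission
  imports Defs
begin

text \<open>
  Write \<open>G(\<nu>\<^sub>1, \<dots>, \<nu>\<^sub>N)\<close> for the expectation of \<open>log det (I + c \<Sum>\<^sub>j y\<^sub>j y\<^sub>j\<^sup>T)\<close> with independent
  \<open>y\<^sub>j \<sim> \<nu>\<^sub>j\<close>. This is symmetric and affine in each slot. Condition on all samples but two, \<open>y\<close> and \<open>z\<close>,
  and let \<open>B\<close> be the matrix of the others. By the matrix determinant lemma the integrand is
  \<open>log det B + p(y) + p(z) + log (1 - s(y, z)\<^sup>2)\<close>, where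
  \<open>s(y, z) = c y\<^sup>T B\<^sup>-\<^sup>1 z / sqrt ((1 + c y\<^sup>T B\<^sup>-\<^sup>1 y) (1 + c z\<^sup>T B\<^sup>-\<^sup>1 z))\<close> is a positive semidefinite kernel. All
  powers of \<open>s\<close> are then positive semidefinite, and expanding the logarithm shows that
  \<open>log (1 - s\<^sup>2)\<close> has nonpositive energy against \<open>(\<mu> - \<sigma>) \<otimes> (\<mu> - \<sigma>)\<close>. Hence \<open>G\<close> with \<open>k\<close> slots equal to
  \<open>\<mu>\<close> and \<open>N - k\<close> slots equal to \<open>\<sigma>\<close> is a concave sequence in \<open>k\<close> and lies below its tangent at \<open>k = 0\<close>.
  The tangent is affine in \<open>\<mu>\<close>, so averaging it over \<open>\<mu> = \<kappa> \<theta>\<close> with \<open>\<sigma> = \<integral> \<kappa> \<theta> \<pi>(d\<theta>)\<close> gives the inequality for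
  mixtures. Convex combinations and the orthogonal average are mixtures.
\<close>

subsection \<open>Determinants of rank-one updates\<close>

definition outer_product :: "real^'q \<Rightarrow> real^'q \<Rightarrow> real^'q^'q" where
  "outer_product u v = (\<chi> i j. u $ i * v $ j)"

lemma outer_product_mult_vec: "outer_product u v *v x = (v \<bullet> x) *\<^sub>R u"
  by (simp add: vec_eq_iff outer_product_def matrix_vector_mult_def inner_vec_def
      sum_distrib_left mult_ac)

lemma outer_square_eq: "outer_square y = outer_product y y"
  by (simp add: vec_eq_iff outer_square_def outer_product_def matrix_matrix_mult_def
      columnvector_def transpose_def)

lemma outer_square_mult_vec: "outer_square y *v x = (y \<bullet> x) *\<^sub>R y"
  by (simp add: outer_square_eq outer_product_mult_vec)

text \<open>An orthogonal \<open>Q\<close> takes \<open>norm v *\<^sub>R axis k 1\<close> to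
  \<open>v\<close>. Conjugating by \<open>Q\<close> leaves the determinant alone and turns the
  update into a matrix that differs from the identity in column \<open>k\<close> only, so Cramer's
  rule gives its determinant.\<close>

lemma det_rank_one_update_id:
  fixes u v :: "real^'q"
  shows "det (mat 1 + outer_product u v) = 1 + u \<bullet> v"
proof -
  obtain k :: 'q where True by blast
  obtain f :: "real^'q \<Rightarrow> real^'q" where f: "orthogonal_transformation f" "f (norm v *\<^sub>R axis k 1) = v"
    using rotation_rightward_line by blast
  define Q where "Q = matrix f"
  have Q: "orthogonal_matrix Q" and fQ: "\<And>x. f x = Q *v x"
    using f(1) by (auto simp: Q_def orthogonal_transformation_matrix matrix_works)
  have QQ: "transpose Q ** Q = mat 1" "Q ** transpose Q = mat 1"
    using Q by (auto simp: orthogonal_matrix_def)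
  define w where "w = transpose Q *v u"
  have v: "v = norm v *\<^sub>R (Q *v axis k 1)"
    using f(2) by (simp add: fQ matrix_vector_mult_scaleR)
  have vQ: "v \<bullet> (Q *v x) = norm v * x $ k" for x
  proof -
    have "v \<bullet> (Q *v x) = norm v * ((Q *v axis k 1) \<bullet> (Q *v x))"
      by (subst v) simp
    also have "(Q *v axis k 1) \<bullet> (Q *v x) = axis k 1 \<bullet> x"
      using f(1) by (simp add: orthogonal_transformation_def fQ)
    finally show ?thesis by (simp add: inner_axis')
  qed
  have Qw: "w $ k * norm v = u \<bullet> v"
  proof -
    have "w $ k = axis k 1 \<bullet> w" by (simp add: inner_axis')
    also have "\<dots> = (Q *v axis k 1) \<bullet> u"
      using dot_lmul_matrix[of "axis k 1" "transpose Q" u] transpose_matrix_vector[of "transpose Q" "axis k 1"]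
      by (simp add: w_def)
    finally show ?thesis by (subst (2) v) (simp add: inner_commute)
  qed
  \<comment> \<open>The factor \<open>mat 1 *v\<close> is kept to give the right side the shape of
    \<open>cramer_lemma\<close> with the identity as coefficient matrix.\<close>
  have "transpose Q ** (mat 1 + outer_product u v) ** Q =
      (\<chi> i j. if j = k then (mat 1 *v (axis k 1 + norm v *\<^sub>R w)) $ i else mat 1 $ i $ j)"
    (is "?L = ?R")
  proof (subst matrix_eq, intro allI)
    fix x :: "real^'q"
    have "?L *v x = transpose Q *v (Q *v x + (v \<bullet> (Q *v x)) *\<^sub>R u)"
      by (simp add: matrix_vector_mul_assoc[symmetric] matrix_vector_mult_add_rdistrib
          outer_product_mult_vec)
    also have "\<dots> = x + (norm v * x $ k) *\<^sub>R w"
      by (simp add: matrix_vector_right_distrib matrix_vector_mult_scaleR vQ w_def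
          matrix_vector_mul_assoc QQ)
    also have "\<dots> = ?R *v x"
    proof (rule vec_eq_iff[THEN iffD2], intro allI)
      fix i
      have "(?R *v x) $ i = (\<Sum>j\<in>UNIV. (if j = k then axis k 1 $ i + norm v * w $ i else mat 1 $ i $ j) * x $ j)"
        by (simp add: matrix_vector_mult_def[of "vec_lambda _"] cong: if_cong)
      also have "\<dots>
        = (\<Sum>j\<in>UNIV. (if j = i then x $ j else 0) + (if j = k then norm v * w $ i * x $ j else 0))"
        by (intro sum.cong) (auto simp: axis_def mat_def algebra_simps)
      finally show "(x + (norm v * x $ k) *\<^sub>R w) $ i = (?R *v x) $ i"
        by (simp add: sum.distrib mult_ac)
    qed
    finally show "?L *v x = ?R *v x" .
  qed
  then have "det ?L = 1 + norm v * w $ k"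
    by (simp only: cramer_lemma det_I) simp
  moreover have "det ?L = det (Q ** transpose Q) * det (mat 1 + outer_product u v)"
    by (simp add: det_mul)
  ultimately show ?thesis
    using Qw by (simp add: QQ mult.commute)
qed

text \<open>Factoring out \<open>A\<close> reduces this to an update of the identity by
  \<open>outer_product (P *v u) v\<close>.\<close>

lemma det_rank_one_update:
  fixes A P :: "real^'q^'q"
  assumes "A ** P = mat 1"
  shows "det (A + outer_product u v) = det A * (1 + v \<bullet> (P *v u))"
proof -
  have "A + outer_product u v = A ** (mat 1 + outer_product (P *v u) v)"
    by (simp add: matrix_eq matrix_vector_mul_assoc[symmetric] matrix_vector_mult_add_rdistrib
        outer_product_mult_vec matrix_vector_right_distrib matrix_vector_mult_scaleR)
       (simp add: matrix_vector_mul_assoc assms)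
  then show ?thesis
    by (simp add: det_mul det_rank_one_update_id inner_commute)
qed

section \<open>The matrix of a finite sample: inverse and determinant bounds\<close>

definition info_matrix :: "real \<Rightarrow> 'i set \<Rightarrow> ('i \<Rightarrow> real^'q) \<Rightarrow> real^'q^'q" where
  "info_matrix c J ys = mat 1 + c *\<^sub>R (\<Sum>j\<in>J. outer_square (ys j))"

lemma sum_matrix_mult_vec: "(\<Sum>j\<in>J. A j) *v (x :: real^'q) = (\<Sum>j\<in>J. A j *v x)"
  by (induction J rule: infinite_finite_induct) (auto simp: matrix_vector_mult_add_rdistrib)

lemma info_matrix_mult_vec:
  "info_matrix c J ys *v x = x + c *\<^sub>R (\<Sum>j\<in>J. (ys j \<bullet> x) *\<^sub>R ys j)"
  by (simp add: info_matrix_def matrix_vector_mult_add_rdistrib scaleR_matrix_vector_assoc[symmetric]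
      sum_matrix_mult_vec outer_square_mult_vec)

lemma info_matrix_form:
  "x \<bullet> (info_matrix c J ys *v z) = x \<bullet> z + c * (\<Sum>j\<in>J. (ys j \<bullet> x) * (ys j \<bullet> z))"
  by (simp add: info_matrix_mult_vec inner_add_right inner_sum_right inner_commute mult_ac)

lemma info_matrix_insert:
  assumes "finite J" "i \<notin> J"
  shows "info_matrix c (insert i J) (ys(i := y)) = info_matrix c J ys + outer_product (c *\<^sub>R y) y"
proof -
  have "(\<Sum>j\<in>J. outer_square ((ys(i := y)) j)) = (\<Sum>j\<in>J. outer_square (ys j))"
    using assms by (intro sum.cong) auto
  moreover have "c *\<^sub>R outer_square y = outer_product (c *\<^sub>R y) y"
    by (simp add: outer_square_eq outer_product_def vec_eq_iff)
  ultimately show ?thesis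
    using assms by (simp add: info_matrix_def scaleR_add_right add_ac)
qed

lemma info_matrix_cong:
  "(\<And>j. j \<in> J \<Longrightarrow> ys j = zs j) \<Longrightarrow> info_matrix c J ys = info_matrix c J zs"
  by (simp add: info_matrix_def)

text \<open>The quadratic form of the matrix dominates that of the identity, so its kernel is
  trivial.\<close>

lemma info_matrix_invertible:
  fixes ys :: "'i \<Rightarrow> real^'q"
  assumes "c \<ge> 0"
  obtains P where "info_matrix c J ys ** P = mat 1" "P ** info_matrix c J ys = mat 1"
proof -
  have "x = 0" if "info_matrix c J ys *v x = 0" for x
  proof -
    have "0 = x \<bullet> x + c * (\<Sum>j\<in>J. (ys j \<bullet> x) * (ys j \<bullet> x))"
      using info_matrix_form[of x c J ys x] that by simp
    moreover have "0 \<le> c * (\<Sum>j\<in>J. (ys j \<bullet> x) * (ys j \<bullet> x))"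
      using assms by (intro mult_nonneg_nonneg sum_nonneg zero_le_square)
    ultimately have "x \<bullet> x \<le> 0" by linarith
    then show "x = 0" by (metis inner_eq_zero_iff inner_ge_zero order_antisym)
  qed
  then have "inj ((*v) (info_matrix c J ys))"
    by (simp add: linear_injective_0)
  then show ?thesis
    using that by (metis matrix_left_invertible_injective matrix_left_right_inverse)
qed

text \<open>The identity for \<open>y \<bullet> (P *v z)\<close> is the source of the features in
  \<open>ln_det_info_matrix_insert2\<close>. On the diagonal it gives
  \<open>(norm (P *v y))\<^sup>2 \<le> y \<bullet> (P *v y)\<close>; together with Cauchy-Schwarz
  this yields the upper bound.\<close>

lemma info_matrix_inverse:
  fixes ys :: "'i \<Rightarrow> real^'q"
  assumes "c \<ge> 0"
  obtains P where "info_matrix c J ys ** P = mat 1" "P ** info_matrix c J ys = mat 1"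
    "\<And>y z. y \<bullet> (P *v z) = (P *v y) \<bullet> (P *v z) + c * (\<Sum>j\<in>J. (ys j \<bullet> (P *v y)) * (ys j \<bullet> (P *v z)))"
    "\<And>y. y \<bullet> (P *v y) \<ge> 0" "\<And>y. y \<bullet> (P *v y) \<le> (norm y)\<^sup>2"
proof -
  obtain P where P: "info_matrix c J ys ** P = mat 1" "P ** info_matrix c J ys = mat 1"
    using info_matrix_invertible[OF assms] by metis
  \<comment> \<open>\<open>P = P B P\<close> with \<open>B = I + c \<Sum>\<^sub>j y\<^sub>j y\<^sub>j\<^sup>T\<close> writes the form of \<open>P\<close> as a sum of products of
    linear functionals, without a square root of \<open>P\<close>.\<close>
  have form: "y \<bullet> (P *v z) = (P *v y) \<bullet> (P *v z) + c * (\<Sum>j\<in>J. (ys j \<bullet> (P *v y)) * (ys j \<bullet> (P *v z)))"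
    for y z
  proof -
    have "y = info_matrix c J ys *v (P *v y)"
      by (simp add: matrix_vector_mul_assoc P)
    then have "y \<bullet> (P *v z) = (P *v z) \<bullet> (info_matrix c J ys *v (P *v y))"
      by (metis inner_commute)
    also have "\<dots> = (P *v y) \<bullet> (P *v z) + c * (\<Sum>j\<in>J. (ys j \<bullet> (P *v y)) * (ys j \<bullet> (P *v z)))"
      unfolding info_matrix_form by (simp add: inner_commute mult.commute)
    finally show ?thesis .
  qed
  have ge: "(norm (P *v y))\<^sup>2 \<le> y \<bullet> (P *v y)" for y
    unfolding form[of y y]
    using assms by (simp add: power2_norm_eq_inner mult_nonneg_nonneg sum_nonneg)
  have nn: "0 \<le> y \<bullet> (P *v y)" for y
    by (rule order_trans[OF _ ge]) simp
  have le: "y \<bullet> (P *v y) \<le> (norm y)\<^sup>2" for y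
  proof -
    have CS: "y \<bullet> (P *v y) \<le> norm y * norm (P *v y)"
      by (rule norm_cauchy_schwarz)
    with ge[of y] have "norm (P *v y) * norm (P *v y) \<le> norm y * norm (P *v y)"
      by (simp add: power2_eq_square)
    then have "norm (P *v y) \<le> norm y"
      by (metis mult_right_le_imp_le norm_ge_zero order_le_less)
    with CS show ?thesis
      by (metis (no_types, opaque_lifting) mult_left_mono norm_ge_zero order_trans power2_eq_square)
  qed
  show ?thesis
    using that[OF P form nn le] .
qed

text \<open>Each new sample \<open>y\<close> multiplies the determinant by
  \<open>1 + c * (y \<bullet> (P *v y))\<close>, where \<open>P\<close> inverts the matrix of the
  earlier samples; this factor lies between \<open>1\<close> and
  \<open>1 + c * (norm y)\<^sup>2\<close>.\<close>

lemma det_info_matrix_bounds: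
  fixes ys :: "'i \<Rightarrow> real^'q"
  assumes "finite J" "c \<ge> 0"
  shows "1 \<le> det (info_matrix c J ys)"
    and "det (info_matrix c J ys) \<le> (\<Prod>j\<in>J. 1 + c * (norm (ys j))\<^sup>2)"
proof -
  have "1 \<le> det (info_matrix c J ys) \<and> det (info_matrix c J ys) \<le> (\<Prod>j\<in>J. 1 + c * (norm (ys j))\<^sup>2)"
    using assms(1)
  proof (induction J rule: finite_induct)
    case empty
    then show ?case by (simp add: info_matrix_def)
  next
    case (insert i J)
    obtain P where P: "info_matrix c J ys ** P = mat 1"
      "\<And>y. y \<bullet> (P *v y) \<ge> 0" "\<And>y. y \<bullet> (P *v y) \<le> (norm y)\<^sup>2"
      using info_matrix_inverse[OF assms(2), of J ys] by metis
    have "info_matrix c (insert i J) ys = info_matrix c J ys + outer_product (c *\<^sub>R ys i) (ys i)"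
      using info_matrix_insert[OF insert.hyps, of c ys "ys i"] by simp
    then have det: "det (info_matrix c (insert i J) ys) =
        det (info_matrix c J ys) * (1 + c * (ys i \<bullet> (P *v ys i)))"
      by (simp add: det_rank_one_update[OF P(1)] matrix_vector_mult_scaleR)
    have "0 \<le> c * (ys i \<bullet> (P *v ys i))" "c * (ys i \<bullet> (P *v ys i)) \<le> c * (norm (ys i))\<^sup>2"
      using P assms(2) by (auto intro: mult_left_mono)
    moreover from calculation have "1 * 1 \<le> det (info_matrix c J ys) * (1 + c * (ys i \<bullet> (P *v ys i)))"
      using insert.IH by (intro mult_mono) auto
    moreover have "det (info_matrix c J ys) * (1 + c * (ys i \<bullet> (P *v ys i)))
        \<le> (\<Prod>j\<in>J. 1 + c * (norm (ys j))\<^sup>2) * (1 + c * (norm (ys i))\<^sup>2)"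
      using calculation insert.IH by (intro mult_mono) auto
    ultimately show ?case
      using insert.hyps by (simp add: det mult.commute)
  qed
  then show "1 \<le> det (info_matrix c J ys)"
    and "det (info_matrix c J ys) \<le> (\<Prod>j\<in>J. 1 + c * (norm (ys j))\<^sup>2)" by auto
qed

section \<open>Splitting off two samples\<close>

lemma det_info_matrix_insert2:
  fixes ys :: "'i \<Rightarrow> real^'q"
  assumes "finite J" "i \<notin> J" "j \<notin> J" "i \<noteq> j" "c \<ge> 0"
    and P: "info_matrix c J ys ** P = mat 1" "P ** info_matrix c J ys = mat 1"
    and sym: "z \<bullet> (P *v y) = y \<bullet> (P *v z)" and nn: "y \<bullet> (P *v y) \<ge> 0"
  shows "det (info_matrix c (insert i (insert j J)) (ys(j := z, i := y))) =
    det (info_matrix c J ys) *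
      ((1 + c * (y \<bullet> (P *v y))) * (1 + c * (z \<bullet> (P *v z))) - (c * (y \<bullet> (P *v z)))\<^sup>2)"
proof -
  define B where "B = info_matrix c J ys"
  define B' where "B' = info_matrix c (insert i J) (ys(i := y))"
  have B': "B' = B + outer_product (c *\<^sub>R y) y"
    using assms by (simp add: B_def B'_def info_matrix_insert)
  obtain P' where P': "B' ** P' = mat 1"
    using info_matrix_invertible[OF \<open>c \<ge> 0\<close>, of "insert i J" "ys(i := y)"] by (metis B'_def)
  \<comment> \<open>The second update involves the inverse \<open>P'\<close> taken after the first
    one. Solving \<open>B' *v w = z\<close> for \<open>w\<close> expresses its contribution through
    \<open>P\<close> alone, as in the Sherman-Morrison formula.\<close>
  define w where "w = P' *v z"
  have "z = B' *v w"
    by (simp add: w_def matrix_vector_mul_assoc P')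
  then have z: "z = B *v w + (c * (y \<bullet> w)) *\<^sub>R y"
    by (simp add: B' matrix_vector_mult_add_rdistrib outer_product_mult_vec mult.commute)
  have "P *v z = w + (c * (y \<bullet> w)) *\<^sub>R (P *v y)"
    by (subst z) (simp add: matrix_vector_right_distrib matrix_vector_mult_scaleR
        matrix_vector_mul_assoc P(2)[folded B_def])
  then have "y \<bullet> (P *v z) = (y \<bullet> w) * (1 + c * (y \<bullet> (P *v y)))"
    and zw: "z \<bullet> (P *v z) = z \<bullet> w + c * (y \<bullet> w) * (y \<bullet> (P *v z))"
    by (simp_all add: inner_add_right sym algebra_simps)
  moreover have "1 + c * (y \<bullet> (P *v y)) \<noteq> 0"
    using nn \<open>c \<ge> 0\<close> by (metis add_pos_nonneg less_irrefl mult_nonneg_nonneg zero_less_one)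
  \<comment> \<open>Multiplying by the factor from the first update clears the denominator of
    \<open>y \<bullet> w\<close>.\<close>
  ultimately have yw: "(1 + c * (y \<bullet> (P *v y))) * (1 + c * (z \<bullet> w)) =
      (1 + c * (y \<bullet> (P *v y))) * (1 + c * (z \<bullet> (P *v z))) - (c * (y \<bullet> (P *v z)))\<^sup>2"
    by (simp add: zw power2_eq_square algebra_simps)
  have "insert i (insert j J) = insert j (insert i J)" "ys(j := z, i := y) = (ys(i := y))(j := z)"
    using assms by auto
  then have "det (info_matrix c (insert i (insert j J)) (ys(j := z, i := y))) =
      det (B' + outer_product (c *\<^sub>R z) z)"
    using info_matrix_insert[of "insert i J" j c "ys(i := y)" z] assms(1-4) by (simp only: B'_def) simp
  also have "\<dots> = det B' * (1 + c * (z \<bullet> w))"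
    by (simp add: det_rank_one_update[OF P'] w_def matrix_vector_mult_scaleR)
  also have "det B' = det B * (1 + c * (y \<bullet> (P *v y)))"
    by (simp add: B' det_rank_one_update[OF P(1)[folded B_def]] matrix_vector_mult_scaleR)
  finally show ?thesis
    unfolding yw[symmetric] B_def by (simp only: mult.assoc)
qed

text \<open>Dividing the two-sample determinant by \<open>a y * a z\<close>, with
  \<open>a y = 1 + c * (y \<bullet> (P *v y))\<close>, leaves \<open>1 - s\<^sup>2\<close> for a
  normalised kernel \<open>s\<close>. So \<open>p\<close> is \<open>ln (a y)\<close>, and
  \<open>f\<close> lists finitely many features whose products sum to \<open>s\<close>, which is how
  positive semidefiniteness is recorded.\<close>

lemma ln_det_info_matrix_insert2:
  fixes ys :: "'i \<Rightarrow> real^'q"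
  assumes "finite J" "i \<notin> J" "j \<notin> J" "i \<noteq> j" "c \<ge> 0"
  obtains p :: "real^'q \<Rightarrow> real" and X :: "('q + 'i) set" and f :: "'q + 'i \<Rightarrow> real^'q \<Rightarrow> real"
  where "\<And>y z. ln (det (info_matrix c (insert i (insert j J)) (ys(j := z, i := y)))) =
      ln (det (info_matrix c J ys)) + p y + p z + ln (1 - (\<Sum>k\<in>X. f k y * f k z)\<^sup>2)"
    "\<And>y z. (\<Sum>k\<in>X. f k y * f k z)\<^sup>2 < 1"
    "finite X" "\<And>k. f k \<in> borel_measurable borel" "p \<in> borel_measurable borel"
    "\<And>k y. k \<in> X \<Longrightarrow> \<bar>f k y\<bar> \<le> 1"
    "\<And>y. 0 \<le> p y" "\<And>y. p y \<le> ln (1 + c * (norm y)\<^sup>2)"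
proof -
  define B where "B = info_matrix c J ys"
  obtain P where P: "B ** P = mat 1" "P ** B = mat 1"
    and form: "\<And>y z. y \<bullet> (P *v z) = (P *v y) \<bullet> (P *v z) + c * (\<Sum>j\<in>J. (ys j \<bullet> (P *v y)) * (ys j \<bullet> (P *v z)))"
    and nn: "\<And>y. y \<bullet> (P *v y) \<ge> 0" and le: "\<And>y. y \<bullet> (P *v y) \<le> (norm y)\<^sup>2"
    by (rule info_matrix_inverse[OF \<open>c \<ge> 0\<close>, where J = J and ys = ys, folded B_def])
       (rule that)
  have sym: "y \<bullet> (P *v z) = z \<bullet> (P *v y)" for y z
    unfolding form[of y z] form[of z y] by (simp add: inner_commute mult.commute)
  define a where "a y = 1 + c * (y \<bullet> (P *v y))" for y
  define X where "X = (UNIV :: 'q set) <+> J"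
  \<comment> \<open>The features are read off from \<open>form\<close>: coordinates of
    \<open>P *v y\<close>, then inner products with the samples in \<open>J\<close>. After the
    common factor \<open>c\<close> is distributed, the first sum carries \<open>c\<close> and the
    second \<open>c * c\<close>, hence the prefactors \<open>sqrt c\<close> and
    \<open>c\<close>.\<close>
  define f where "f k y = (case k of Inl l \<Rightarrow> sqrt c * (P *v y) $ l | Inr l \<Rightarrow> c * (ys l \<bullet> (P *v y))) / sqrt (a y)"
    for k :: "'q + 'i" and y
  have a1: "1 \<le> a y" for y
    using nn[of y] \<open>c \<ge> 0\<close> by (simp add: a_def)
  have finX: "finite X"
    using assms(1) by (simp add: X_def)
  have ff: "(\<Sum>k\<in>X. f k y * f k z) = c * (y \<bullet> (P *v z)) / (sqrt (a y) * sqrt (a z))" for y z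
  proof -
    have "f (Inl l) y * f (Inl l) z = (sqrt c * sqrt c) * ((P *v y) $ l * (P *v z) $ l) / (sqrt (a y) * sqrt (a z))" for l
      by (simp only: f_def sum.case times_divide_times_eq mult_ac)
    then have Inl: "f (Inl l) y * f (Inl l) z = c * ((P *v y) $ l * (P *v z) $ l) / (sqrt (a y) * sqrt (a z))" for l
      using assms(5) by simp
    have Inr: "f (Inr l) y * f (Inr l) z =
        c * (c * ((ys l \<bullet> (P *v y)) * (ys l \<bullet> (P *v z)))) / (sqrt (a y) * sqrt (a z))" for l
      by (simp only: f_def sum.case times_divide_times_eq mult_ac)
    have "(\<Sum>k\<in>X. f k y * f k z) =
      ((\<Sum>l\<in>UNIV. c * ((P *v y) $ l * (P *v z) $ l)) +
       (\<Sum>l\<in>J. c * (c * ((ys l \<bullet> (P *v y)) * (ys l \<bullet> (P *v z)))))) / (sqrt (a y) * sqrt (a z))"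
      using assms(1)
      by (simp only: X_def sum.Plus finite o_def Inl Inr add_divide_distrib sum_divide_distrib)
    also have "\<dots> = c * (y \<bullet> (P *v z)) / (sqrt (a y) * sqrt (a z))"
      unfolding form[of y z] by (simp add: inner_vec_def sum_distrib_left distrib_left)
    finally show ?thesis .
  qed
  have sq: "(\<Sum>k\<in>X. f k y * f k z)\<^sup>2 = (c * (y \<bullet> (P *v z)))\<^sup>2 / (a y * a z)" for y z
    using a1[of y] a1[of z] by (simp add: ff power_divide power_mult_distrib)
  have det: "det (info_matrix c (insert i (insert j J)) (ys(j := z, i := y))) =
    det B * (a y * a z * (1 - (\<Sum>k\<in>X. f k y * f k z)\<^sup>2))" for y z
  proof -
    have "det (info_matrix c (insert i (insert j J)) (ys(j := z, i := y))) =
      det B * (a y * a z - (c * (y \<bullet> (P *v z)))\<^sup>2)"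
      unfolding a_def B_def
      by (rule det_info_matrix_insert2) (use assms P sym nn in \<open>auto simp: B_def\<close>)
    then show ?thesis
      using a1[of y] a1[of z] by (simp add: sq right_diff_distrib)
  qed
  have B1: "det B \<ge> 1"
    using det_info_matrix_bounds(1)[OF assms(1,5)] by (simp add: B_def)
  \<comment> \<open>Strictness comes from the determinant with all samples being at least 1, hence
    positive.\<close>
  have lt1: "(\<Sum>k\<in>X. f k y * f k z)\<^sup>2 < 1" for y z
  proof -
    have "0 < det B * (a y * a z * (1 - (\<Sum>k\<in>X. f k y * f k z)\<^sup>2))"
      unfolding det[symmetric] using assms
      by (intro less_le_trans[OF zero_less_one det_info_matrix_bounds(1)]) auto
    moreover have "0 < det B" "0 < a y * a z"
      using B1 a1[of y] a1[of z] by auto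
    ultimately show ?thesis
      by (metis diff_gt_0_iff_gt zero_less_mult_pos)
  qed
  show ?thesis
  proof (rule that[of "\<lambda>y. ln (a y)" f X])
    fix y z
    show "ln (det (info_matrix c (insert i (insert j J)) (ys(j := z, i := y)))) =
      ln (det (info_matrix c J ys)) + ln (a y) + ln (a z) + ln (1 - (\<Sum>k\<in>X. f k y * f k z)\<^sup>2)"
      unfolding det B_def[symmetric] using B1 a1[of y] a1[of z] lt1[of y z] by (simp add: ln_mult)
    show "(\<Sum>k\<in>X. f k y * f k z)\<^sup>2 < 1" by (rule lt1)
  next
    have meas: "(\<lambda>y. P *v y) \<in> borel_measurable borel"
      by (intro borel_measurable_continuous_onI matrix_vector_mult_linear_continuous_on)
    have inner: "(\<lambda>y. u \<bullet> (P *v y)) \<in> borel_measurable borel" for u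
      by (intro borel_measurable_inner meas borel_measurable_const)
    have "(\<lambda>y. y \<bullet> (P *v y)) \<in> borel_measurable borel"
      by (intro borel_measurable_inner meas measurable_ident_sets refl)
    then have ma[measurable]: "a \<in> borel_measurable borel"
      unfolding a_def by measurable
    show "(\<lambda>y. ln (a y)) \<in> borel_measurable borel"
      by measurable
    show "f k \<in> borel_measurable borel" for k
    proof (cases k)
      case (Inl l)
      have "(\<lambda>y. (P *v y) $ l) \<in> borel_measurable borel"
        using inner[of "axis l 1"] by (simp add: inner_axis')
      then show ?thesis unfolding f_def Inl by simp
    next
      case (Inr l)
      show ?thesis unfolding f_def Inr using inner[of "ys l"] by simp
    qed
  next
    fix k y assume "k \<in> X"
    \<comment> \<open>A single squared feature is at most the diagonal value of the kernel, which is
      \<open>1 - 1 / a y\<close>.\<close>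
    have "(f k y)\<^sup>2 \<le> (\<Sum>k\<in>X. f k y * f k y)"
      using \<open>k \<in> X\<close> finX by (subst power2_eq_square) (rule member_le_sum, auto)
    also have "\<dots> = (a y - 1) / a y"
      using a1[of y] by (simp add: ff) (simp add: a_def)
    also have "\<dots> \<le> 1\<^sup>2"
      using a1[of y] by (simp add: divide_simps)
    finally show "\<bar>f k y\<bar> \<le> 1"
      by (simp add: abs_square_le_1)
  next
    fix y
    show "0 \<le> ln (a y)" using a1 by simp
    show "ln (a y) \<le> ln (1 + c * (norm y)\<^sup>2)"
      using a1[of y] le[of y] \<open>c \<ge> 0\<close> by (intro ln_mono) (auto simp: a_def mult_left_mono)
  qed (rule finX)
qed

section \<open>Invariance under orthogonal maps\<close>

lemma orthogonal_matrix_inner: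
  fixes Q :: "real^'q^'q"
  shows "(Q *v x) \<bullet> z = x \<bullet> (transpose Q *v z)"
  by (metis dot_lmul_matrix inner_commute transpose_matrix_vector)

lemma norm_orthogonal_matrix_mult:
  fixes Q :: "real^'q^'q"
  assumes "orthogonal_matrix Q"
  shows "norm (Q *v x) = norm x"
  using assms by (simp add: norm_eq orthogonal_matrix_inner matrix_vector_mul_assoc orthogonal_matrix_def)

text \<open>Rotating all samples conjugates the matrix by \<open>Q\<close>.\<close>

lemma det_info_matrix_orthogonal:
  fixes Q :: "real^'q^'q"
  assumes Q: "orthogonal_matrix Q"
  shows "det (info_matrix c J (\<lambda>j. Q *v ys j)) = det (info_matrix c J ys)"
proof -
  have QQ: "Q ** transpose Q = mat 1" using Q by (simp add: orthogonal_matrix_def)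
  have "info_matrix c J (\<lambda>j. Q *v ys j) = Q ** info_matrix c J ys ** transpose Q"
  proof (subst matrix_eq, intro allI)
    fix x
    have "(Q ** info_matrix c J ys ** transpose Q) *v x =
        Q *v (transpose Q *v x + c *\<^sub>R (\<Sum>j\<in>J. (ys j \<bullet> (transpose Q *v x)) *\<^sub>R ys j))"
      by (simp add: matrix_vector_mul_assoc[symmetric] info_matrix_mult_vec)
    also have "\<dots> = x + c *\<^sub>R (\<Sum>j\<in>J. (ys j \<bullet> (transpose Q *v x)) *\<^sub>R (Q *v ys j))"
      by (simp add: matrix_vector_right_distrib matrix_vector_mult_scaleR matrix_vector_mul_assoc QQ
          del: transpose_matrix_vector add: linear_sum[OF matrix_vector_mul_linear])
    also have "\<dots> = info_matrix c J (\<lambda>j. Q *v ys j) *v x"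
      by (simp add: info_matrix_mult_vec orthogonal_matrix_inner)
    finally show "info_matrix c J (\<lambda>j. Q *v ys j) *v x = (Q ** info_matrix c J ys ** transpose Q) *v x" ..
  qed
  then have "det (info_matrix c J (\<lambda>j. Q *v ys j)) = det (Q ** transpose Q) * det (info_matrix c J ys)"
    by (simp add: det_mul)
  then show ?thesis by (simp add: QQ)
qed

subsection \<open>Energy of positive semidefinite kernels\<close>

text \<open>This is the integral of \<open>K\<close> against the signed product (\<mu> - \<sigma>)
  \<otimes> (\<mu> - \<sigma>), expanded into four integrals against probability measures.\<close>

definition energy_gap :: "'a measure \<Rightarrow> 'a measure \<Rightarrow> ('a \<times> 'a \<Rightarrow> real) \<Rightarrow> real" where
  "energy_gap \<mu> \<sigma> K =
     (\<integral>x. K x \<partial>(\<mu> \<Otimes>\<^sub>M \<mu>)) + (\<integral>x. K x \<partial>(\<sigma> \<Otimes>\<^sub>M \<sigma>)) - (\<integral>x. K x \<partial>(\<mu> \<Otimes>\<^sub>M \<sigma>)) - (\<integral>x. K x \<partial>(\<sigma> \<Otimes>\<^sub>M \<mu>))"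

lemma (in pair_prob_space) integral_additive_kernel:
  fixes p r :: "_ \<Rightarrow> real"
  assumes p: "integrable M1 p" and r: "integrable M2 r"
  shows "integrable (M1 \<Otimes>\<^sub>M M2) (\<lambda>(y, z). p y + r z)"
    and "(\<integral>x. (case x of (y, z) \<Rightarrow> p y + r z) \<partial>(M1 \<Otimes>\<^sub>M M2)) = (\<integral>y. p y \<partial>M1) + (\<integral>z. r z \<partial>M2)"
proof -
  have [measurable]: "p \<in> borel_measurable M1" "r \<in> borel_measurable M2"
    using p r by auto
  have *: "integrable (M1 \<Otimes>\<^sub>M M2) (\<lambda>(y, z). p y)"
    by (rule Fubini_integrable) (use p in \<open>auto simp: M2.prob_space\<close>)
  interpret Q: pair_prob_space M2 M1 ..
  have "integrable (M2 \<Otimes>\<^sub>M M1) (\<lambda>(z, y). r z)"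
    by (rule Q.Fubini_integrable) (use r in \<open>auto simp: M1.prob_space\<close>)
  then have "integrable (M1 \<Otimes>\<^sub>M M2) (\<lambda>(y, z). r z)"
    using Q.integrable_product_swap by fastforce
  with * have "integrable (M1 \<Otimes>\<^sub>M M2) (\<lambda>x. (case x of (y, z) \<Rightarrow> p y) + (case x of (y, z) \<Rightarrow> r z))"
    by (rule Bochner_Integration.integrable_add)
  then show int: "integrable (M1 \<Otimes>\<^sub>M M2) (\<lambda>(y, z). p y + r z)"
    by (simp add: case_prod_unfold)
  show "(\<integral>x. (case x of (y, z) \<Rightarrow> p y + r z) \<partial>(M1 \<Otimes>\<^sub>M M2)) = (\<integral>y. p y \<partial>M1) + (\<integral>z. r z \<partial>M2)"
    using integral_fst'[OF int] p r by (simp add: M1.prob_space M2.prob_space)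
qed

text \<open>This passes from iterated nonnegative integrals, which come out of the product measure,
  to real integrals, in which energies can be subtracted. Integrability of \<open>l\<close> needs no
  separate estimate: \<open>l \<le> 0\<close> while the total is nonnegative, so
  \<open>C + p y + r z\<close> dominates its absolute value.\<close>

lemma (in pair_prob_space) nn_integral_additive_plus_nonpos:
  fixes p r :: "_ \<Rightarrow> real"
  assumes p: "integrable M1 p" and r: "integrable M2 r"
    and l: "l \<in> borel_measurable (M1 \<Otimes>\<^sub>M M2)" "\<And>x. l x \<le> 0"
    and nn: "\<And>y z. 0 \<le> C + p y + r z + l (y, z)"
  shows "integrable (M1 \<Otimes>\<^sub>M M2) l"
    and "(\<integral>\<^sup>+y. \<integral>\<^sup>+z. ennreal (C + p y + r z + l (y, z)) \<partial>M2 \<partial>M1) =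
      ennreal (C + (\<integral>y. p y \<partial>M1) + (\<integral>z. r z \<partial>M2) + (\<integral>x. l x \<partial>(M1 \<Otimes>\<^sub>M M2)))"
    and "0 \<le> C + (\<integral>y. p y \<partial>M1) + (\<integral>z. r z \<partial>M2) + (\<integral>x. l x \<partial>(M1 \<Otimes>\<^sub>M M2))"
proof -
  let ?u = "\<lambda>(y, z). p y + r z"
  note u = integral_additive_kernel[OF p r]
  have [measurable]: "p \<in> borel_measurable M1" "r \<in> borel_measurable M2"
    using p r by auto
  note [measurable] = l(1)
  have "norm (l x) \<le> norm (C + ?u x)" for x
    using l(2)[of x] nn[of "fst x" "snd x"] by (auto simp: case_prod_unfold)
  then show int: "integrable (M1 \<Otimes>\<^sub>M M2) l"
    by (intro Bochner_Integration.integrable_bound[OF Bochner_Integration.integrable_add[OF integrable_const[of C] u(1)] l(1)])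
       (auto simp del: real_norm_def)
  have intg: "integrable (M1 \<Otimes>\<^sub>M M2) (\<lambda>x. C + ?u x + l x)"
    using int u(1) by auto
  have eq: "(\<integral>x. C + ?u x + l x \<partial>(M1 \<Otimes>\<^sub>M M2)) =
      C + (\<integral>y. p y \<partial>M1) + (\<integral>z. r z \<partial>M2) + (\<integral>x. l x \<partial>(M1 \<Otimes>\<^sub>M M2))"
    using int u by (simp add: prob_space)
  have nn': "0 \<le> C + ?u x + l x" for x
    using nn[of "fst x" "snd x"] by (auto simp: case_prod_unfold add.assoc)
  have "(\<integral>\<^sup>+y. \<integral>\<^sup>+z. ennreal (C + p y + r z + l (y, z)) \<partial>M2 \<partial>M1) =
      (\<integral>\<^sup>+x. ennreal (C + ?u x + l x) \<partial>(M1 \<Otimes>\<^sub>M M2))"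
    by (subst M2.nn_integral_fst[symmetric]) (auto simp: add.assoc)
  also have "\<dots> = ennreal (\<integral>x. C + ?u x + l x \<partial>(M1 \<Otimes>\<^sub>M M2))"
    using intg nn' by (intro nn_integral_eq_integral) auto
  finally show "(\<integral>\<^sup>+y. \<integral>\<^sup>+z. ennreal (C + p y + r z + l (y, z)) \<partial>M2 \<partial>M1) =
      ennreal (C + (\<integral>y. p y \<partial>M1) + (\<integral>z. r z \<partial>M2) + (\<integral>x. l x \<partial>(M1 \<Otimes>\<^sub>M M2)))"
    unfolding eq .
  show "0 \<le> C + (\<integral>y. p y \<partial>M1) + (\<integral>z. r z \<partial>M2) + (\<integral>x. l x \<partial>(M1 \<Otimes>\<^sub>M M2))"
    unfolding eq[symmetric] using nn' by (intro Bochner_Integration.integral_nonneg) auto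
qed

section \<open>Sign of the energy for two laws on the same measurable space\<close>

locale two_laws = \<mu>: prob_space \<mu> + \<sigma>: prob_space \<sigma> for \<mu> \<sigma> :: "'a measure" +
  assumes sets_eq: "sets \<mu> = sets \<sigma>"
begin

sublocale \<mu>\<mu>: pair_prob_space \<mu> \<mu> ..
sublocale \<mu>\<sigma>: pair_prob_space \<mu> \<sigma> ..
sublocale \<sigma>\<mu>: pair_prob_space \<sigma> \<mu> ..
sublocale \<sigma>\<sigma>: pair_prob_space \<sigma> \<sigma> ..

lemma sets_pair_eq:
  "sets (\<mu> \<Otimes>\<^sub>M \<mu>) = sets (\<sigma> \<Otimes>\<^sub>M \<sigma>)" "sets (\<mu> \<Otimes>\<^sub>M \<sigma>) = sets (\<sigma> \<Otimes>\<^sub>M \<sigma>)"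
  "sets (\<sigma> \<Otimes>\<^sub>M \<mu>) = sets (\<sigma> \<Otimes>\<^sub>M \<sigma>)"
  by (intro sets_pair_measure_cong sets_eq refl)+

text \<open>A Bochner integral of a non-integrable function is 0 by default, so linearity of
  \<open>energy_gap\<close> is claimed under this condition.\<close>

definition integrable4 :: "('a \<times> 'a \<Rightarrow> real) \<Rightarrow> bool" where
  "integrable4 K \<longleftrightarrow> integrable (\<mu> \<Otimes>\<^sub>M \<mu>) K \<and> integrable (\<sigma> \<Otimes>\<^sub>M \<sigma>) K \<and>
     integrable (\<mu> \<Otimes>\<^sub>M \<sigma>) K \<and> integrable (\<sigma> \<Otimes>\<^sub>M \<mu>) K"

lemma integrable4_bounded:
  assumes "K \<in> borel_measurable (\<sigma> \<Otimes>\<^sub>M \<sigma>)" "\<And>x. \<bar>K x\<bar> \<le> B"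
  shows "integrable4 K"
  unfolding integrable4_def using assms
  by (auto intro!: \<mu>\<mu>.integrable_const_bound[where B = B] \<sigma>\<sigma>.integrable_const_bound[where B = B]
      \<mu>\<sigma>.integrable_const_bound[where B = B] \<sigma>\<mu>.integrable_const_bound[where B = B]
      simp: measurable_cong_sets[OF sets_pair_eq(1) refl] measurable_cong_sets[OF sets_pair_eq(2) refl]
      measurable_cong_sets[OF sets_pair_eq(3) refl])

lemma energy_gap_cmult:
  assumes "integrable4 K"
  shows "integrable4 (\<lambda>x. r * K x)" "energy_gap \<mu> \<sigma> (\<lambda>x. r * K x) = r * energy_gap \<mu> \<sigma> K"
  using assms by (auto simp: integrable4_def energy_gap_def algebra_simps)

lemma energy_gap_sum:
  assumes "\<And>k. k \<in> X \<Longrightarrow> integrable4 (K k)"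
  shows "integrable4 (\<lambda>x. \<Sum>k\<in>X. K k x)" "energy_gap \<mu> \<sigma> (\<lambda>x. \<Sum>k\<in>X. K k x) = (\<Sum>k\<in>X. energy_gap \<mu> \<sigma> (K k))"
  using assms by (auto simp: integrable4_def energy_gap_def sum.distrib sum_subtractf)

text \<open>Powers of a positive semidefinite kernel are positive semidefinite. The weight
  \<open>w\<close> makes an induction on \<open>n\<close> possible: for exponent 0 the energy is the
  square of the difference of the means of \<open>w\<close> under \<mu> and \<sigma>, and a higher
  power is a sum of weighted lower ones.\<close>

lemma energy_gap_power_kernel:
  assumes w: "w \<in> borel_measurable \<sigma>" "\<And>y. \<bar>w y\<bar> \<le> (1::real)"
    and f: "finite X" "\<And>k. f k \<in> borel_measurable \<sigma>" "\<And>k y. k \<in> X \<Longrightarrow> \<bar>f k y\<bar> \<le> (1::real)"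
  shows "integrable4 (\<lambda>(y, z). w y * w z * (\<Sum>k\<in>X. f k y * f k z) ^ n)"
    and "energy_gap \<mu> \<sigma> (\<lambda>(y, z). w y * w z * (\<Sum>k\<in>X. f k y * f k z) ^ n) \<ge> 0"
proof -
  note [measurable] = f(2)
  \<comment> \<open>Stated for every bounded weight and every exponent, because the induction
    changes both.\<close>
  have int: "integrable4 (\<lambda>(y, z). w y * w z * (\<Sum>k\<in>X. f k y * f k z) ^ n)"
    if [measurable]: "w \<in> borel_measurable \<sigma>" and wb: "\<And>y. \<bar>w y\<bar> \<le> 1" for w n
  proof (rule integrable4_bounded[where B = "real (card X) ^ n"])
    show "\<bar>case x of (y, z) \<Rightarrow> w y * w z * (\<Sum>k\<in>X. f k y * f k z) ^ n\<bar> \<le> real (card X) ^ n" for x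
    proof -
      obtain y z where x: "x = (y, z)" by fastforce
      have "\<bar>\<Sum>k\<in>X. f k y * f k z\<bar> \<le> (\<Sum>k\<in>X. 1)"
        by (rule order_trans[OF sum_abs sum_mono])
           (auto simp: abs_mult intro!: mult_le_one f)
      then have "\<bar>\<Sum>k\<in>X. f k y * f k z\<bar> ^ n \<le> real (card X) ^ n"
        by (intro power_mono) auto
      moreover have "\<bar>w y\<bar> * \<bar>w z\<bar> \<le> 1"
        by (intro mult_le_one wb) auto
      ultimately have "\<bar>w y\<bar> * \<bar>w z\<bar> * \<bar>\<Sum>k\<in>X. f k y * f k z\<bar> ^ n \<le> 1 * real (card X) ^ n"
        by (intro mult_mono) auto
      then show ?thesis by (simp add: x abs_mult power_abs)
    qed
  qed measurable
  show "integrable4 (\<lambda>(y, z). w y * w z * (\<Sum>k\<in>X. f k y * f k z) ^ n)"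
    by (rule int[OF w])
  show "energy_gap \<mu> \<sigma> (\<lambda>(y, z). w y * w z * (\<Sum>k\<in>X. f k y * f k z) ^ n) \<ge> 0"
    using w
  proof (induction n arbitrary: w)
    case (0 w)
    have I: "integrable4 (\<lambda>(y, z). w y * w z)"
      using int[OF 0, of 0] by simp
    have "(\<integral>x. (case x of (y, z) \<Rightarrow> w y * w z) \<partial>(\<mu> \<Otimes>\<^sub>M \<mu>)) = (\<integral>y. w y \<partial>\<mu>) * (\<integral>y. w y \<partial>\<mu>)"
      using I by (subst \<mu>\<mu>.integral_fst'[symmetric]) (auto simp: integrable4_def)
    moreover have "(\<integral>x. (case x of (y, z) \<Rightarrow> w y * w z) \<partial>(\<sigma> \<Otimes>\<^sub>M \<sigma>)) = (\<integral>y. w y \<partial>\<sigma>) * (\<integral>y. w y \<partial>\<sigma>)"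
      using I by (subst \<sigma>\<sigma>.integral_fst'[symmetric]) (auto simp: integrable4_def)
    moreover have "(\<integral>x. (case x of (y, z) \<Rightarrow> w y * w z) \<partial>(\<mu> \<Otimes>\<^sub>M \<sigma>)) = (\<integral>y. w y \<partial>\<mu>) * (\<integral>y. w y \<partial>\<sigma>)"
      using I by (subst \<mu>\<sigma>.integral_fst'[symmetric]) (auto simp: integrable4_def)
    moreover have "(\<integral>x. (case x of (y, z) \<Rightarrow> w y * w z) \<partial>(\<sigma> \<Otimes>\<^sub>M \<mu>)) = (\<integral>y. w y \<partial>\<sigma>) * (\<integral>y. w y \<partial>\<mu>)"
      using I by (subst \<sigma>\<mu>.integral_fst'[symmetric]) (auto simp: integrable4_def)
    ultimately have "energy_gap \<mu> \<sigma> (\<lambda>(y, z). w y * w z) = ((\<integral>y. w y \<partial>\<mu>) - (\<integral>y. w y \<partial>\<sigma>))\<^sup>2"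
      by (simp add: energy_gap_def power2_eq_square algebra_simps)
    then show ?case by simp
  next
    \<comment> \<open>One factor \<open>f k y * f k z\<close> of the power is absorbed into the weight.\<close>
    case (Suc n w)
    note [measurable] = Suc.prems(1)
    have wf: "(\<lambda>y. w y * f k y) \<in> borel_measurable \<sigma>" "k \<in> X \<Longrightarrow> \<bar>w y * f k y\<bar> \<le> 1" for k y
      using Suc.prems(2)[of y] f(3)[of k y] by (auto simp: abs_mult intro!: mult_le_one)
    have "(\<lambda>(y, z). w y * w z * (\<Sum>k\<in>X. f k y * f k z) ^ Suc n) =
      (\<lambda>x. \<Sum>k\<in>X. (\<lambda>(y, z). (w y * f k y) * (w z * f k z) * (\<Sum>k\<in>X. f k y * f k z) ^ n) x)"
      by (auto simp: fun_eq_iff sum_distrib_left sum_distrib_right mult_ac intro!: sum.cong)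
    moreover have "energy_gap \<mu> \<sigma> (\<lambda>(y, z). (w y * f k y) * (w z * f k z) * (\<Sum>k\<in>X. f k y * f k z) ^ n) \<ge> 0"
      if "k \<in> X" for k
      by (rule Suc.IH[OF wf(1) wf(2)[OF that]])
    moreover have "integrable4 (\<lambda>(y, z). (w y * f k y) * (w z * f k z) * (\<Sum>k\<in>X. f k y * f k z) ^ n)"
      if "k \<in> X" for k
      by (rule int[OF wf(1) wf(2)[OF that]])
    ultimately show ?case
      by (simp only: energy_gap_sum) (rule sum_nonneg)
  qed
qed

text \<open>The series of \<open>- ln (1 - s\<^sup>2)\<close> has nonnegative coefficients and even
  powers of \<open>s\<close>, each with nonnegative energy. Its terms are themselves nonnegative, so
  the full sum dominates every partial sum and dominated convergence applies.\<close>

lemma energy_gap_ln_kernel: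
  assumes f: "finite X" "\<And>k. f k \<in> borel_measurable \<sigma>" "\<And>k y. k \<in> X \<Longrightarrow> \<bar>f k y\<bar> \<le> (1::real)"
    and lt: "\<And>y z. (\<Sum>k\<in>X. f k y * f k z)\<^sup>2 < 1"
    and int: "integrable4 (\<lambda>(y, z). ln (1 - (\<Sum>k\<in>X. f k y * f k z)\<^sup>2))"
  shows "energy_gap \<mu> \<sigma> (\<lambda>(y, z). ln (1 - (\<Sum>k\<in>X. f k y * f k z)\<^sup>2)) \<le> 0"
proof -
  define k where "k = (\<lambda>x. (\<Sum>k\<in>X. f k (fst x) * f k (snd x))\<^sup>2)"
  \<comment> \<open>The term \<open>m = 0\<close> vanishes since \<open>inverse 0 = 0\<close>, so
    the series effectively starts at \<open>m = 1\<close>.\<close>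
  define s where "s n x = (\<Sum>m<n. inverse (real m) * k x ^ m)" for n x
  have kS: "k x ^ m = (case x of (y, z) \<Rightarrow> 1 * 1 * (\<Sum>k\<in>X. f k y * f k z) ^ (2 * m))" for x m
    by (simp add: k_def power_mult split: prod.split)
  have power: "integrable4 (\<lambda>x. k x ^ m)" "energy_gap \<mu> \<sigma> (\<lambda>x. k x ^ m) \<ge> 0" for m
    unfolding kS by (rule energy_gap_power_kernel[OF _ _ f]; simp)+
  have s: "integrable4 (s n)" "energy_gap \<mu> \<sigma> (s n) \<ge> 0" for n
    unfolding s_def using power
    by (auto simp: energy_gap_sum energy_gap_cmult intro!: sum_nonneg energy_gap_cmult energy_gap_sum)
  have k01: "0 \<le> k x" "k x < 1" for x
    using lt by (auto simp: k_def)
  have sums: "(\<lambda>n. inverse (real n) * k x ^ n) sums - ln (1 - k x)" for x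
    using sums_minus[OF ln_series'[of "- k x"]] k01[of x] by (simp add: field_simps)
  then have lim: "(\<lambda>n. s n x) \<longlonglongrightarrow> - ln (1 - k x)" for x
    by (simp add: s_def sums_def)
  have bound: "norm (s n x) \<le> - ln (1 - k x)" for n x
  proof -
    have "0 \<le> s n x"
      unfolding s_def using k01 by (intro sum_nonneg) auto
    moreover have "s n x \<le> - ln (1 - k x)"
      unfolding s_def using sums_unique[OF sums[of x]] k01[of x]
      by (simp, intro sum_le_suminf sums_summable[OF sums]) auto
    ultimately show ?thesis by simp
  qed
  have lnk: "(\<lambda>(y, z). ln (1 - (\<Sum>k\<in>X. f k y * f k z)\<^sup>2)) = (\<lambda>x. ln (1 - k x))"
    by (auto simp: k_def)
  have *: "(\<lambda>n. \<integral>x. s n x \<partial>M) \<longlonglongrightarrow> (\<integral>x. - ln (1 - k x) \<partial>M)"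
    if "integrable M (\<lambda>x. ln (1 - k x))" "\<And>n. integrable M (s n)" for M
    by (rule integral_dominated_convergence[where w = "\<lambda>x. - ln (1 - k x)"])
       (use that lim bound in auto)
  have "(\<lambda>n. energy_gap \<mu> \<sigma> (s n)) \<longlonglongrightarrow> energy_gap \<mu> \<sigma> (\<lambda>x. - ln (1 - k x))"
    unfolding energy_gap_def using int s(1) unfolding lnk
    by (intro tendsto_intros *) (auto simp: integrable4_def)
  then have "0 \<le> energy_gap \<mu> \<sigma> (\<lambda>x. - ln (1 - k x))"
    by (rule LIMSEQ_le_const) (use s in auto)
  then show ?thesis
    unfolding lnk by (simp add: energy_gap_def)
qed

text \<open>The contributions of \<open>C\<close> and \<open>p\<close> cancel in this second
  difference, and what remains is the energy of the logarithmic kernel.\<close>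

lemma iterated_integral_ln_kernel_le:
  assumes f: "finite X" "\<And>k. f k \<in> borel_measurable \<sigma>" "\<And>k y. k \<in> X \<Longrightarrow> \<bar>f k y\<bar> \<le> (1::real)"
    and lt: "\<And>y z. (\<Sum>k\<in>X. f k y * f k z)\<^sup>2 < 1"
    and g: "\<And>y z. g y z = C + p y + p z + ln (1 - (\<Sum>k\<in>X. f k y * f k z)\<^sup>2)"
    and g0: "\<And>y z. 0 \<le> g y z"
    and p: "integrable \<mu> p" "integrable \<sigma> p"
  shows "(\<integral>\<^sup>+y. \<integral>\<^sup>+z. ennreal (g y z) \<partial>\<mu> \<partial>\<mu>) + (\<integral>\<^sup>+y. \<integral>\<^sup>+z. ennreal (g y z) \<partial>\<sigma> \<partial>\<sigma>)
    \<le> 2 * (\<integral>\<^sup>+y. \<integral>\<^sup>+z. ennreal (g y z) \<partial>\<sigma> \<partial>\<mu>)"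
proof -
  define l where "l = (\<lambda>(y, z). ln (1 - (\<Sum>k\<in>X. f k y * f k z)\<^sup>2))"
  note [measurable] = f(2)
  have l: "l \<in> borel_measurable (\<sigma> \<Otimes>\<^sub>M \<sigma>)"
    unfolding l_def by measurable
  have l4: "l \<in> borel_measurable (\<mu> \<Otimes>\<^sub>M \<mu>)" "l \<in> borel_measurable (\<mu> \<Otimes>\<^sub>M \<sigma>)"
    "l \<in> borel_measurable (\<sigma> \<Otimes>\<^sub>M \<mu>)"
    using l by (auto simp: measurable_cong_sets[OF sets_pair_eq(1) refl]
        measurable_cong_sets[OF sets_pair_eq(2) refl] measurable_cong_sets[OF sets_pair_eq(3) refl])
  have l0: "l x \<le> 0" for x
    using lt by (auto simp: l_def split: prod.split)
  have gl: "g y z = C + p y + p z + l (y, z)" for y z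
    by (simp add: g l_def)
  have nn: "0 \<le> C + p y + p z + l (y, z)" for y z
    using g0[of y z] by (simp add: gl)
  note mm = \<mu>\<mu>.nn_integral_additive_plus_nonpos[OF p(1) p(1) l4(1) l0 nn]
  note ms = \<mu>\<sigma>.nn_integral_additive_plus_nonpos[OF p(1) p(2) l4(2) l0 nn]
  note sm = \<sigma>\<mu>.nn_integral_additive_plus_nonpos[OF p(2) p(1) l4(3) l0 nn]
  note ss = \<sigma>\<sigma>.nn_integral_additive_plus_nonpos[OF p(2) p(2) l l0 nn]
  have "energy_gap \<mu> \<sigma> l \<le> 0"
    unfolding l_def using mm(1) ms(1) sm(1) ss(1)
    by (intro energy_gap_ln_kernel[OF f lt]) (auto simp: integrable4_def l_def)
  \<comment> \<open>The kernel is symmetric, so the two mixed integrals merge into the factor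
    2.\<close>
  moreover have "(\<integral>x. l x \<partial>(\<sigma> \<Otimes>\<^sub>M \<mu>)) = (\<integral>x. l x \<partial>(\<mu> \<Otimes>\<^sub>M \<sigma>))"
    using \<mu>\<sigma>.integral_product_swap[OF l4(2)]
    by (simp add: l_def mult.commute)
  ultimately have "(C + (\<integral>y. p y \<partial>\<mu>) + (\<integral>z. p z \<partial>\<mu>) + (\<integral>x. l x \<partial>(\<mu> \<Otimes>\<^sub>M \<mu>))) +
      (C + (\<integral>y. p y \<partial>\<sigma>) + (\<integral>z. p z \<partial>\<sigma>) + (\<integral>x. l x \<partial>(\<sigma> \<Otimes>\<^sub>M \<sigma>))) \<le>
      2 * (C + (\<integral>y. p y \<partial>\<mu>) + (\<integral>z. p z \<partial>\<sigma>) + (\<integral>x. l x \<partial>(\<mu> \<Otimes>\<^sub>M \<sigma>)))"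
    by (simp add: energy_gap_def algebra_simps)
  moreover have "ennreal a + ennreal b \<le> 2 * ennreal d" if "0 \<le> a" "0 \<le> b" "0 \<le> d" "a + b \<le> 2 * d" for a b d
    using ennreal_leI[OF that(4)] that by (simp add: ennreal_mult)
  ultimately show ?thesis
    unfolding gl mm(2) ms(2) ss(2) using mm(3) ms(3) ss(3) by blast
qed

end

subsection \<open>The mean log-determinant for independent samples\<close>

lemma log_moment_lawsD:
  assumes "\<sigma> \<in> log_moment_laws"
  shows "prob_space \<sigma>" "sets \<sigma> = sets borel" "integrable \<sigma> (\<lambda>y. ln (1 + (norm y)\<^sup>2))"
  using assms by (auto simp: log_moment_laws_def space_prob_algebra)

lemma log_moment_laws_iff:
  "\<sigma> \<in> log_moment_laws \<longleftrightarrow>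
    prob_space \<sigma> \<and> sets \<sigma> = sets borel \<and> (\<integral>\<^sup>+y. ennreal (ln (1 + (norm y)\<^sup>2)) \<partial>\<sigma>) < \<infinity>"
proof -
  have "(\<lambda>y. ln (1 + (norm y)\<^sup>2)) \<in> borel_measurable \<sigma>" if "sets \<sigma> = sets borel"
    unfolding measurable_cong_sets[OF that refl] by measurable
  then show ?thesis
    by (auto simp: log_moment_laws_def space_prob_algebra integrable_iff_bounded)
qed

text \<open>Scaling costs only a constant, since \<open>1 + c * r \<le> (1 + c) * (1 + r)\<close>
  for nonnegative \<open>c\<close> and \<open>r\<close>.\<close>

lemma integrable_ln_scaled:
  assumes \<sigma>: "\<sigma> \<in> log_moment_laws" and "c \<ge> 0"
  shows "integrable \<sigma> (\<lambda>y. ln (1 + c * (norm y)\<^sup>2))"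
proof -
  note \<sigma> = log_moment_lawsD[OF \<sigma>]
  interpret prob_space \<sigma> by (rule \<sigma>)
  have "(\<lambda>y. ln (1 + c * (norm y)\<^sup>2)) \<in> borel_measurable \<sigma>"
    unfolding measurable_cong_sets[OF \<sigma>(2) refl] by measurable
  moreover have "norm (ln (1 + c * (norm y)\<^sup>2)) \<le> norm (ln (1 + c) + ln (1 + (norm y)\<^sup>2))" for y
  proof -
    have "0 \<le> c * (norm y)\<^sup>2" using \<open>c \<ge> 0\<close> by simp
    then have "ln (1 + c * (norm y)\<^sup>2) \<le> ln ((1 + c) * (1 + (norm y)\<^sup>2))"
      using \<open>c \<ge> 0\<close> by (intro ln_mono) (auto simp: algebra_simps intro: add_pos_nonneg)
    also have "\<dots> = ln (1 + c) + ln (1 + (norm y)\<^sup>2)"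
      using \<open>c \<ge> 0\<close> by (intro ln_mult_pos) (auto intro: add_pos_nonneg)
    finally have "ln (1 + c * (norm y)\<^sup>2) \<le> ln (1 + c) + ln (1 + (norm y)\<^sup>2)" .
    moreover have "0 \<le> ln (1 + c * (norm y)\<^sup>2)" using \<open>0 \<le> c * (norm y)\<^sup>2\<close> by simp
    ultimately show ?thesis by simp
  qed
  ultimately show ?thesis
    by (intro Bochner_Integration.integrable_bound[OF Bochner_Integration.integrable_add[OF integrable_const[of "ln (1 + c)"] \<sigma>(3)]]) auto
qed

abbreviation log_det :: "real \<Rightarrow> 'i set \<Rightarrow> ('i \<Rightarrow> real^'q) \<Rightarrow> real" where
  "log_det c I ys \<equiv> ln (det (info_matrix c I ys))"

lemma log_det_bounds:
  assumes "finite I" "c \<ge> 0"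
  shows "0 \<le> log_det c I ys" "log_det c I ys \<le> (\<Sum>i\<in>I. ln (1 + c * (norm (ys i))\<^sup>2))"
proof -
  note b = det_info_matrix_bounds[OF assms, of ys]
  show "0 \<le> log_det c I ys" using b by simp
  have "log_det c I ys \<le> ln (\<Prod>j\<in>I. 1 + c * (norm (ys j))\<^sup>2)"
    using b by (intro ln_mono) auto
  also have "\<dots> = (\<Sum>i\<in>I. ln (1 + c * (norm (ys i))\<^sup>2))"
    using add_pos_nonneg[OF zero_less_one mult_nonneg_nonneg[OF assms(2) zero_le_power2]]
      assms(1)
    by (intro ln_prod) (auto simp: less_imp_neq[symmetric])
  finally show "log_det c I ys \<le> (\<Sum>i\<in>I. ln (1 + c * (norm (ys i))\<^sup>2))" .
qed

lemma measurable_log_det: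
  assumes "\<And>i. i \<in> I \<Longrightarrow> sets (\<nu> i) = sets (borel :: (real^'q) measure)"
  shows "log_det c I \<in> borel_measurable (PiM I \<nu>)"
proof -
  have "sets (PiM I \<nu>) = sets (PiM I (\<lambda>_. borel :: (real^'q) measure))"
    using assms by (intro sets_PiM_cong) auto
  moreover have "log_det c I \<in> borel_measurable (PiM I (\<lambda>_. borel :: (real^'q) measure))"
  proof -
    have entry: "(\<lambda>ys. info_matrix c I ys $ k $ l) \<in> borel_measurable (PiM I (\<lambda>_. borel :: (real^'q) measure))" for k l
    proof -
      have "info_matrix c I ys $ k $ l = mat 1 $ k $ l + c * (\<Sum>i\<in>I. (ys i \<bullet> axis k 1) * (ys i \<bullet> axis l 1))" for ys :: "_ \<Rightarrow> real^'q"
        by (simp add: info_matrix_def outer_square_eq outer_product_def inner_axis)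
      then show ?thesis by simp
    qed
    show ?thesis
      unfolding det_def by (intro borel_measurable_ln borel_measurable_sum borel_measurable_times borel_measurable_prod borel_measurable_const entry)
  qed
  ultimately show ?thesis
    using measurable_cong_sets by blast
qed

text \<open>The functional \<open>G\<close> of the introduction, with one law per slot. Values in
  \<open>ennreal\<close> allow slots to be integrated out and laws to be averaged before finiteness
  is known.\<close>

definition mean_log_det :: "real \<Rightarrow> 'i set \<Rightarrow> ('i \<Rightarrow> (real^'q) measure) \<Rightarrow> ennreal" where
  "mean_log_det c I \<nu> = (\<integral>\<^sup>+ys. ennreal (log_det c I ys) \<partial>PiM I \<nu>)"

lemma mean_log_det_cong:
  "(\<And>i. i \<in> I \<Longrightarrow> \<nu> i = \<nu>' i) \<Longrightarrow> mean_log_det c I \<nu> = mean_log_det c I \<nu>'"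
  unfolding mean_log_det_def by (simp cong: PiM_cong)

text \<open>The bound in \<open>log_det_bounds\<close> is a sum over samples, and each summand sees
  only one marginal of the product law.\<close>

lemma mean_log_det_finite:
  assumes "finite I" "c \<ge> 0" and \<nu>: "\<And>i. i \<in> I \<Longrightarrow> \<nu> i \<in> log_moment_laws"
  shows "mean_log_det c I \<nu> < \<infinity>"
proof -
  have f: "(\<lambda>y. ennreal (ln (1 + c * (norm y)\<^sup>2))) \<in> borel_measurable (\<nu> i)" if "i \<in> I" for i
    unfolding measurable_cong_sets[OF log_moment_lawsD(2)[OF \<nu>[OF that]] refl] by measurable
  have fin: "(\<integral>\<^sup>+ys. ennreal (ln (1 + c * (norm (ys i))\<^sup>2)) \<partial>PiM I \<nu>) < \<infinity>" if "i \<in> I" for i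
  proof -
    have "(\<integral>\<^sup>+ys. ennreal (ln (1 + c * (norm (ys i))\<^sup>2)) \<partial>PiM I \<nu>) =
        (\<integral>\<^sup>+y. ennreal (ln (1 + c * (norm y)\<^sup>2)) \<partial>distr (PiM I \<nu>) (\<nu> i) (\<lambda>ys. ys i))"
      by (rule nn_integral_distr[symmetric]) (use f[OF that] that in simp_all)
    also have "distr (PiM I \<nu>) (\<nu> i) (\<lambda>ys. ys i) = \<nu> i"
      using log_moment_lawsD(1)[OF \<nu>] assms(1) that by (intro distr_PiM_component)
    also have "(\<integral>\<^sup>+y. ennreal (ln (1 + c * (norm y)\<^sup>2)) \<partial>\<nu> i) < \<infinity>"
      using integrable_ln_scaled[OF \<nu>[OF that] assms(2)] assms(2)
      by (simp add: integrable_iff_bounded)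
    finally show ?thesis .
  qed
  have "mean_log_det c I \<nu> \<le> (\<integral>\<^sup>+ys. (\<Sum>i\<in>I. ennreal (ln (1 + c * (norm (ys i))\<^sup>2))) \<partial>PiM I \<nu>)"
    unfolding mean_log_det_def
  proof (rule nn_integral_mono)
    show "ennreal (log_det c I ys) \<le> (\<Sum>i\<in>I. ennreal (ln (1 + c * (norm (ys i))\<^sup>2)))" for ys
      using ennreal_leI[OF log_det_bounds(2)[OF assms(1,2), of ys]] assms(2) by simp
  qed
  also have "\<dots> = (\<Sum>i\<in>I. \<integral>\<^sup>+ys. ennreal (ln (1 + c * (norm (ys i))\<^sup>2)) \<partial>PiM I \<nu>)"
  proof (rule nn_integral_sum)
    fix i assume "i \<in> I"
    then show "(\<lambda>ys. ennreal (ln (1 + c * (norm (ys i))\<^sup>2))) \<in> borel_measurable (PiM I \<nu>)"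
      using measurable_compose[of "\<lambda>ys. ys i" "PiM I \<nu>" "\<nu> i", OF _ f]
        measurable_component_singleton[of i I \<nu>] by blast
  qed
  also have "\<dots> < \<infinity>"
    using assms(1) fin by simp
  finally show ?thesis .
qed

lemma log_moment_laws_sigma_finite: "\<sigma> \<in> log_moment_laws \<Longrightarrow> sigma_finite_measure \<sigma>"
  using log_moment_lawsD(1) prob_space_imp_sigma_finite by blast

text \<open>With the samples \<open>xs\<close> in \<open>J\<close> fixed, the inequality is
  \<open>iterated_integral_ln_kernel_le\<close>, applied to the decomposition of the log-determinant
  at \<open>xs\<close>; it is then integrated over \<open>xs\<close>.\<close>

lemma mean_log_det_two_slots:
  fixes \<nu> :: "'i \<Rightarrow> (real^'q) measure"
  assumes J: "finite J" "i \<notin> J" "j \<notin> J" "i \<noteq> j" and c: "c \<ge> 0"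
    and \<nu>: "\<And>k. \<nu> k \<in> log_moment_laws" and \<mu>: "\<mu> \<in> log_moment_laws" and \<sigma>: "\<sigma> \<in> log_moment_laws"
  shows "mean_log_det c (insert i (insert j J)) (\<nu>(j := \<mu>, i := \<mu>)) +
      mean_log_det c (insert i (insert j J)) (\<nu>(j := \<sigma>, i := \<sigma>))
    \<le> 2 * mean_log_det c (insert i (insert j J)) (\<nu>(j := \<mu>, i := \<sigma>))"
proof -
  let ?I = "insert i (insert j J)"
  let ?g = "\<lambda>ys. ennreal (log_det c ?I ys)"
  let ?H = "\<lambda>\<beta> \<alpha> xs. \<integral>\<^sup>+z. \<integral>\<^sup>+y. ?g (xs(j := z, i := y)) \<partial>\<alpha> \<partial>\<beta>"
  have expand: "mean_log_det c ?I (\<nu>(j := \<beta>, i := \<alpha>)) = (\<integral>\<^sup>+xs. ?H \<beta> \<alpha> xs \<partial>PiM J \<nu>)"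
    and meas: "?H \<beta> \<alpha> \<in> borel_measurable (PiM J \<nu>)"
    if \<alpha>: "\<alpha> \<in> log_moment_laws" and \<beta>: "\<beta> \<in> log_moment_laws" for \<alpha> \<beta>
  proof -
    define \<rho> where "\<rho> = \<nu>(j := \<beta>, i := \<alpha>)"
    have \<rho>: "\<rho> k \<in> log_moment_laws" for k
      using \<nu> \<alpha> \<beta> by (simp add: \<rho>_def)
    interpret product_sigma_finite \<rho>
      using \<rho> by (simp add: product_sigma_finite_def log_moment_laws_sigma_finite)
    interpret \<alpha>: sigma_finite_measure \<alpha> using \<alpha> by (rule log_moment_laws_sigma_finite)
    interpret \<beta>: sigma_finite_measure \<beta> using \<beta> by (rule log_moment_laws_sigma_finite)
    have [simp]: "\<rho> i = \<alpha>" "\<rho> j = \<beta>" using J by (auto simp: \<rho>_def)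
    have g[measurable]: "?g \<in> borel_measurable (PiM ?I \<rho>)"
      using measurable_log_det[of ?I \<rho> c] log_moment_lawsD(2)[OF \<rho>] by measurable
    have [measurable]: "(\<lambda>(xs, y). xs(i := y)) \<in> PiM (insert j J) \<rho> \<Otimes>\<^sub>M \<alpha> \<rightarrow>\<^sub>M PiM ?I \<rho>"
      using measurable_add_dim[of i "insert j J" \<rho>] by simp
    have [measurable]: "(\<lambda>(xs, z). xs(j := z)) \<in> PiM J \<rho> \<Otimes>\<^sub>M \<beta> \<rightarrow>\<^sub>M PiM (insert j J) \<rho>"
      using measurable_add_dim[of j J \<rho>] by simp
    have inner[measurable]: "(\<lambda>xs. \<integral>\<^sup>+y. ?g (xs(i := y)) \<partial>\<alpha>) \<in> borel_measurable (PiM (insert j J) \<rho>)"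
      by measurable
    have PJ: "PiM J \<rho> = PiM J \<nu>"
      using J by (intro PiM_cong) (auto simp: \<rho>_def)
    have "mean_log_det c ?I \<rho> = (\<integral>\<^sup>+xs. (\<integral>\<^sup>+y. ?g (xs(i := y)) \<partial>\<alpha>) \<partial>PiM (insert j J) \<rho>)"
      unfolding mean_log_det_def using J by (subst product_nn_integral_insert[OF _ _ g]) auto
    also have "\<dots> = (\<integral>\<^sup>+xs. ?H \<beta> \<alpha> xs \<partial>PiM J \<rho>)"
      using J by (subst product_nn_integral_insert[OF _ _ inner]) auto
    finally show "mean_log_det c ?I (\<nu>(j := \<beta>, i := \<alpha>)) = (\<integral>\<^sup>+xs. ?H \<beta> \<alpha> xs \<partial>PiM J \<nu>)"
      by (simp add: PJ flip: \<rho>_def)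
    show "?H \<beta> \<alpha> \<in> borel_measurable (PiM J \<nu>)"
      unfolding PJ[symmetric] by measurable
  qed
  have le: "?H \<mu> \<mu> xs + ?H \<sigma> \<sigma> xs \<le> 2 * ?H \<mu> \<sigma> xs" for xs
  proof -
    obtain p :: "real^'q \<Rightarrow> real" and X and f :: "'q + 'i \<Rightarrow> real^'q \<Rightarrow> real" where
      eq: "\<And>y z. log_det c ?I (xs(j := z, i := y)) =
        log_det c J xs + p y + p z + ln (1 - (\<Sum>k\<in>X. f k y * f k z)\<^sup>2)"
      and lt: "\<And>y z. (\<Sum>k\<in>X. f k y * f k z)\<^sup>2 < 1"
      and X: "finite X" and f: "\<And>k. f k \<in> borel_measurable borel" and p: "p \<in> borel_measurable borel"
      and f1: "\<And>k y. k \<in> X \<Longrightarrow> \<bar>f k y\<bar> \<le> 1"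
      and p0: "\<And>y. 0 \<le> p y" and p1: "\<And>y. p y \<le> ln (1 + c * (norm y)\<^sup>2)"
      by (rule ln_det_info_matrix_insert2[OF J c, where ys = xs]) (rule that)
    \<comment> \<open>In \<open>?H\<close> the outer variable is \<open>z\<close>, so the
      decomposition is rewritten with \<open>z\<close> as first argument.\<close>
    have eq': "log_det c ?I (xs(j := z, i := y)) =
        log_det c J xs + p z + p y + ln (1 - (\<Sum>k\<in>X. f k z * f k y)\<^sup>2)" for y z
      unfolding eq by (simp add: mult.commute)
    have ip: "integrable \<tau> p" if \<tau>: "\<tau> \<in> log_moment_laws" for \<tau>
    proof (rule Bochner_Integration.integrable_bound[OF integrable_ln_scaled[OF \<tau> c]])
      show "p \<in> borel_measurable \<tau>"
        using p by (simp add: measurable_cong_sets[OF log_moment_lawsD(2)[OF \<tau>] refl])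
      show "AE y in \<tau>. norm (p y) \<le> norm (ln (1 + c * (norm y)\<^sup>2))"
        using p0 p1 by (intro AE_I2) (metis abs_of_nonneg order_trans real_norm_def)
    qed
    interpret two_laws \<mu> \<sigma>
      using \<mu> \<sigma> by (simp add: two_laws_def two_laws_axioms_def log_moment_lawsD)
    show ?thesis
    proof (rule iterated_integral_ln_kernel_le[OF X _ f1 _ eq'])
      show "f k \<in> borel_measurable \<sigma>" for k
        using f by (simp add: measurable_cong_sets[OF log_moment_lawsD(2)[OF \<sigma>] refl])
      show "0 \<le> log_det c ?I (xs(j := z, i := y))" for z y
        using J c by (intro log_det_bounds) auto
    qed (use lt ip \<mu> \<sigma> in auto)
  qed
  have "(\<integral>\<^sup>+xs. ?H \<mu> \<mu> xs \<partial>PiM J \<nu>) + (\<integral>\<^sup>+xs. ?H \<sigma> \<sigma> xs \<partial>PiM J \<nu>) =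
      (\<integral>\<^sup>+xs. ?H \<mu> \<mu> xs + ?H \<sigma> \<sigma> xs \<partial>PiM J \<nu>)"
    by (rule nn_integral_add[symmetric]) (intro meas \<mu> \<sigma>)+
  also have "\<dots> \<le> (\<integral>\<^sup>+xs. 2 * ?H \<mu> \<sigma> xs \<partial>PiM J \<nu>)"
    by (intro nn_integral_mono le)
  also have "\<dots> = 2 * (\<integral>\<^sup>+xs. ?H \<mu> \<sigma> xs \<partial>PiM J \<nu>)"
    by (rule nn_integral_cmult) (intro meas \<mu> \<sigma>)
  finally show ?thesis
    by (simp only: expand \<mu> \<sigma>)
qed

section \<open>The tangent inequality and averaging in one slot\<close>

lemma concave_sequence_le_tangent:
  fixes a :: "nat \<Rightarrow> real"
  assumes "\<And>k. k + 2 \<le> N \<Longrightarrow> a (k + 2) + a k \<le> 2 * a (k + 1)" "k \<le> N"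
  shows "a k \<le> a 0 + real k * (a 1 - a 0)"
proof -
  have step: "k + 1 \<le> N \<Longrightarrow> a (k + 1) - a k \<le> a 1 - a 0" for k
  proof (induction k)
    case (Suc k)
    then show ?case using assms(1)[of k] by simp
  qed simp
  show ?thesis using assms(2)
  proof (induction k)
    case (Suc k)
    then show ?case using step[of k] by (simp add: algebra_simps)
  qed simp
qed

text \<open>Replacing \<sigma> by \<mu> one slot at a time gives a concave sequence, whose last term
  lies below the tangent at the first. The inequality is rearranged to contain sums only, because
  subtraction in \<open>ennreal\<close> is truncated.\<close>

lemma mean_log_det_tangent:
  assumes c: "c \<ge> 0" and "N \<ge> 1" and \<mu>: "\<mu> \<in> log_moment_laws" and \<sigma>: "\<sigma> \<in> log_moment_laws"
  shows "mean_log_det c {1..N} (\<lambda>_. \<mu>) + of_nat (N - 1) * mean_log_det c {1..N} (\<lambda>_. \<sigma>)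
    \<le> of_nat N * mean_log_det c {1..N} ((\<lambda>_. \<sigma>)(1 := \<mu>))"
proof -
  define \<nu> where "\<nu> k = (\<lambda>i::nat. if i \<le> k then \<mu> else \<sigma>)" for k
  define A where "A k = mean_log_det c {1..N} (\<nu> k)" for k
  have \<nu>: "\<nu> k i \<in> log_moment_laws" for k i
    using \<mu> \<sigma> by (simp add: \<nu>_def)
  have fin: "A k < \<infinity>" for k
    unfolding A_def by (rule mean_log_det_finite) (use c \<nu> in auto)
  have step: "A (k + 2) + A k \<le> 2 * A (k + 1)" if "k + 2 \<le> N" for k
  proof -
    \<comment> \<open>Slots \<open>k + 1\<close> and \<open>k + 2\<close> are those in which the
      three configurations \<open>\<nu> k\<close>, \<open>\<nu> (k + 1)\<close> and
      \<open>\<nu> (k + 2)\<close> can differ.\<close>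
    define J where "J = {1..N} - {k + 1, k + 2}"
    have I: "insert (k + 2) (insert (k + 1) J) = {1..N}"
      using that by (auto simp: J_def)
    have J: "finite J" "k + 2 \<notin> J" "k + 1 \<notin> J" "k + 2 \<noteq> k + 1"
      by (auto simp: J_def)
    have "(\<nu> k)(k + 1 := \<mu>, k + 2 := \<mu>) = \<nu> (k + 2)" "(\<nu> k)(k + 1 := \<sigma>, k + 2 := \<sigma>) = \<nu> k"
      "(\<nu> k)(k + 1 := \<mu>, k + 2 := \<sigma>) = \<nu> (k + 1)"
      by (auto simp: \<nu>_def fun_eq_iff)
    then show ?thesis
      using mean_log_det_two_slots[where \<nu> = "\<nu> k", OF J c \<nu> \<mu> \<sigma>] unfolding A_def I by (simp only:)
  qed
  define a where "a k = enn2real (A k)" for k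
  have A: "A k = ennreal (a k)" "0 \<le> a k" for k
    using fin[of k] by (simp_all add: a_def)
  have "a (k + 2) + a k \<le> 2 * a (k + 1)" if "k + 2 \<le> N" for k
  proof -
    have "ennreal (a (k + 2) + a k) \<le> ennreal (2 * a (k + 1))"
      using step[OF that] A(2) unfolding A(1) by (simp add: ennreal_mult)
    then show ?thesis
      using A(2)[of "k + 1"] by (simp only: ennreal_le_iff mult_nonneg_nonneg zero_le_numeral)
  qed
  then have "a N \<le> a 0 + real N * (a 1 - a 0)"
    by (rule concave_sequence_le_tangent) auto
  then have "a N + real (N - 1) * a 0 \<le> real N * a 1"
    using \<open>N \<ge> 1\<close> by (simp add: of_nat_diff algebra_simps)
  then have "ennreal (a N + real (N - 1) * a 0) \<le> ennreal (real N * a 1)"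
    by (rule ennreal_leI)
  then have "A N + of_nat (N - 1) * A 0 \<le> of_nat N * A 1"
    using A(2) by (simp add: A(1) ennreal_mult ennreal_of_nat_eq_real_of_nat)
  moreover have "A N = mean_log_det c {1..N} (\<lambda>_. \<mu>)" "A 0 = mean_log_det c {1..N} (\<lambda>_. \<sigma>)"
    "A 1 = mean_log_det c {1..N} ((\<lambda>_. \<sigma>)(1 := \<mu>))"
    unfolding A_def by (rule mean_log_det_cong; simp add: \<nu>_def)+
  ultimately show ?thesis by simp
qed

text \<open>Integrating out all slots but \<open>i\<close> first gives a function \<open>h\<close>
  that does not depend on \<mu>. The value is therefore affine in \<mu>, in a form that can be
  averaged over any mixture.\<close>

lemma mean_log_det_slot:
  fixes \<sigma> :: "(real^'q) measure"
  assumes "finite I" "i \<in> I" and \<sigma>: "prob_space \<sigma>" "sets \<sigma> = sets borel"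
  obtains h :: "real^'q \<Rightarrow> ennreal" where "h \<in> borel_measurable borel"
    "\<And>\<mu>. prob_space \<mu> \<Longrightarrow> sets \<mu> = sets borel \<Longrightarrow>
      mean_log_det c I ((\<lambda>_. \<sigma>)(i := \<mu>)) = (\<integral>\<^sup>+y. h y \<partial>\<mu>)"
proof -
  define J where "J = I - {i}"
  have I: "I = insert i J" and J: "finite J" "i \<notin> J"
    using assms by (auto simp: J_def)
  define h where "h y = (\<integral>\<^sup>+x. ennreal (log_det c I (x(i := y))) \<partial>PiM J (\<lambda>_. \<sigma>))" for y
  show ?thesis
  proof
    interpret S: product_sigma_finite "\<lambda>_. \<sigma>"
      using \<sigma> by (simp add: product_sigma_finite_def prob_space_imp_sigma_finite)
    interpret finite_product_sigma_finite "\<lambda>_. \<sigma>" J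
      by standard (rule J)
    have [measurable]: "log_det c I \<in> borel_measurable (PiM (insert i J) (\<lambda>_. \<sigma>))"
      unfolding I by (rule measurable_log_det) (rule \<sigma>)
    have [measurable]: "(\<lambda>(y, x). x(i := y)) \<in> \<sigma> \<Otimes>\<^sub>M PiM J (\<lambda>_. \<sigma>) \<rightarrow>\<^sub>M PiM (insert i J) (\<lambda>_. \<sigma>)"
      using measurable_compose[OF measurable_pair_swap' measurable_add_dim[of i J "\<lambda>_. \<sigma>"]]
      by (simp add: case_prod_unfold)
    have "h \<in> borel_measurable \<sigma>"
      unfolding h_def by measurable
    then show "h \<in> borel_measurable borel"
      by (simp add: measurable_cong_sets[OF \<sigma>(2) refl])
  next
    fix \<mu> :: "(real^'q) measure" assume \<mu>: "prob_space \<mu>" "sets \<mu> = sets borel"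
    let ?\<nu> = "(\<lambda>_. \<sigma>)(i := \<mu>)"
    interpret product_sigma_finite ?\<nu>
      using \<sigma> \<mu> by (simp add: product_sigma_finite_def prob_space_imp_sigma_finite)
    have "log_det c I \<in> borel_measurable (PiM (insert i J) ?\<nu>)"
      unfolding I by (rule measurable_log_det) (use \<sigma> \<mu> in auto)
    then have "mean_log_det c I ?\<nu> = (\<integral>\<^sup>+y. (\<integral>\<^sup>+x. ennreal (log_det c I (x(i := y))) \<partial>PiM J ?\<nu>) \<partial>\<mu>)"
      unfolding mean_log_det_def I using J
      by (subst product_nn_integral_insert_rev) auto
    also have "PiM J ?\<nu> = PiM J (\<lambda>_. \<sigma>)"
      using J by (intro PiM_cong) auto
    finally show "mean_log_det c I ?\<nu> = (\<integral>\<^sup>+y. h y \<partial>\<mu>)"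
      unfolding h_def .
  qed
qed

text \<open>Coordinates are peeled off one at a time, each being an integral against a kernel. The
  integrand \<open>f\<close> may depend on \<theta> because the integral over a peeled coordinate
  does.\<close>

lemma measurable_nn_integral_PiM_kernel:
  assumes \<kappa>: "\<kappa> \<in> M \<rightarrow>\<^sub>M prob_algebra N" and "finite I"
    and f: "(\<lambda>(\<theta>, x). f \<theta> x) \<in> borel_measurable (M \<Otimes>\<^sub>M PiM I (\<lambda>_. N))"
  shows "(\<lambda>\<theta>. \<integral>\<^sup>+x. f \<theta> x \<partial>PiM I (\<lambda>_. \<kappa> \<theta>)) \<in> borel_measurable M"
  using assms(2,3)
proof (induction I arbitrary: f rule: finite_induct)
  case empty
  \<comment> \<open>The empty product is the point mass at
    \<open>\<lambda>_. undefined\<close>.\<close>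
  have "(\<lambda>\<theta>. (\<theta>, \<lambda>_. undefined)) \<in> M \<rightarrow>\<^sub>M M \<Otimes>\<^sub>M PiM {} (\<lambda>_. N)"
    by (intro measurable_Pair measurable_ident_sets refl measurable_const) (simp add: space_PiM)
  from measurable_compose[OF this empty.prems] show ?case
    by (simp add: PiM_empty nn_integral_count_space_finite)
next
  case (insert i I)
  have prob: "prob_space (\<kappa> \<theta>)" "sets (\<kappa> \<theta>) = sets N" if "\<theta> \<in> space M" for \<theta>
    using measurable_space[OF \<kappa> that] by (auto simp: space_prob_algebra)
  note [measurable] = insert.prems
  have upd[measurable]: "(\<lambda>(x, y). x(i := y)) \<in> PiM I (\<lambda>_. N) \<Otimes>\<^sub>M N \<rightarrow>\<^sub>M PiM (insert i I) (\<lambda>_. N)"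
    using measurable_add_dim[of i I "\<lambda>_. N"] by simp
  have "(\<lambda>x. \<integral>\<^sup>+y. (case x of (\<theta>, x) \<Rightarrow> f \<theta> (x(i := y))) \<partial>\<kappa> (fst x))
      \<in> borel_measurable (M \<Otimes>\<^sub>M PiM I (\<lambda>_. N))"
    by (rule nn_integral_measurable_subprob_algebra2[where N = N])
       (use measurable_prob_algebraD[OF \<kappa>] in measurable)
  then have "(\<lambda>(\<theta>, x). \<integral>\<^sup>+y. f \<theta> (x(i := y)) \<partial>\<kappa> \<theta>) \<in> borel_measurable (M \<Otimes>\<^sub>M PiM I (\<lambda>_. N))"
    by (simp add: case_prod_unfold)
  from insert.IH[OF this]
  have "(\<lambda>\<theta>. \<integral>\<^sup>+x. \<integral>\<^sup>+y. f \<theta> (x(i := y)) \<partial>\<kappa> \<theta> \<partial>PiM I (\<lambda>_. \<kappa> \<theta>)) \<in> borel_measurable M" .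
  also have "?this \<longleftrightarrow> ?case"
  proof (rule measurable_cong)
    fix \<theta> assume \<theta>: "\<theta> \<in> space M"
    interpret product_sigma_finite "\<lambda>_. \<kappa> \<theta>"
      using prob[OF \<theta>] by (simp add: product_sigma_finite_def prob_space_imp_sigma_finite)
    have "sets (PiM (insert i I) (\<lambda>_. \<kappa> \<theta>)) = sets (PiM (insert i I) (\<lambda>_. N))"
      using prob[OF \<theta>] by (intro sets_PiM_cong) auto
    moreover have "f \<theta> \<in> borel_measurable (PiM (insert i I) (\<lambda>_. N))"
      using measurable_compose[OF measurable_Pair1'[OF \<theta>] insert.prems] by simp
    ultimately have "f \<theta> \<in> borel_measurable (PiM (insert i I) (\<lambda>_. \<kappa> \<theta>))"
      by (simp cong: measurable_cong_sets)
    from product_nn_integral_insert[OF insert.hyps this]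
    show "(\<integral>\<^sup>+x. \<integral>\<^sup>+y. f \<theta> (x(i := y)) \<partial>\<kappa> \<theta> \<partial>PiM I (\<lambda>_. \<kappa> \<theta>)) = (\<integral>\<^sup>+x. f \<theta> x \<partial>PiM (insert i I) (\<lambda>_. \<kappa> \<theta>))" ..
  qed
  finally show ?case .
qed

subsection \<open>Concavity under mixtures\<close>

lemma log_det_sample_eq: "log_det_sample N t = log_det (1 / (real N * t)) {1..N}"
  by (simp add: log_det_sample_def info_matrix_def fun_eq_iff)

lemma measurable_log_det_sample:
  "sets \<sigma> = sets borel \<Longrightarrow> log_det_sample N t \<in> borel_measurable (iid_law N \<sigma>)"
  unfolding log_det_sample_eq by (rule measurable_log_det)

context
  fixes N :: nat and t :: real
  assumes N: "N \<ge> 1" and t: "t > 0"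
begin

lemma log_det_sample_nonneg: "0 \<le> log_det_sample N t ys"
  unfolding log_det_sample_eq using t by (intro log_det_bounds) auto

lemma integrable_log_det_sample:
  assumes \<sigma>: "\<sigma> \<in> log_moment_laws"
  shows "integrable (iid_law N \<sigma>) (log_det_sample N t)"
proof (rule integrableI_nonneg)
  have "mean_log_det (1 / (real N * t)) {1..N} (\<lambda>_. \<sigma>) < \<infinity>"
    using t \<sigma> by (intro mean_log_det_finite) auto
  then show "(\<integral>\<^sup>+ys. ennreal (log_det_sample N t ys) \<partial>iid_law N \<sigma>) < \<infinity>"
    by (simp add: mean_log_det_def log_det_sample_eq)
qed (simp_all only: measurable_log_det_sample[OF log_moment_lawsD(2)[OF \<sigma>]] log_det_sample_nonneg AE_I2)

lemma F_eq_mean_log_det: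
  fixes \<sigma> :: "(real^'q) measure"
  assumes "sets \<sigma> = sets borel"
  shows "F N t \<sigma> = 1 / real CARD('q) * enn2real (mean_log_det (1 / (real N * t)) {1..N} (\<lambda>_. \<sigma>))"
  using integral_eq_nn_integral[OF measurable_log_det_sample[OF assms] AE_I2[OF log_det_sample_nonneg]]
  by (simp add: F_def mean_log_det_def log_det_sample_eq)

text \<open>The tangent inequality at the mixture, in direction \<open>\<kappa> \<theta>\<close>, is
  averaged over \<theta>. The one-slot term averages back to the value at the mixture, and the
  surplus copies of that value cancel.\<close>

lemma F_mixture:
  fixes \<kappa> :: "'b \<Rightarrow> (real^'q) measure"
  assumes \<pi>: "prob_space \<pi>" and \<kappa>: "\<kappa> \<in> \<pi> \<rightarrow>\<^sub>M prob_algebra borel" and \<sigma>: "\<pi> \<bind> \<kappa> \<in> log_moment_laws"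
  shows "AE \<theta> in \<pi>. \<kappa> \<theta> \<in> log_moment_laws"
    and "integrable \<pi> (\<lambda>\<theta>. F N t (\<kappa> \<theta>))"
    and "F N t (\<pi> \<bind> \<kappa>) \<ge> (\<integral>\<theta>. F N t (\<kappa> \<theta>) \<partial>\<pi>)"
proof -
  interpret \<pi>: prob_space \<pi> by (rule \<pi>)
  define c where "c = 1 / (real N * t)"
  have c: "c \<ge> 0" using t by (simp add: c_def)
  have prob: "prob_space (\<kappa> \<theta>)" "sets (\<kappa> \<theta>) = sets borel" if "\<theta> \<in> space \<pi>" for \<theta>
    using measurable_space[OF \<kappa> that] by (auto simp: space_prob_algebra)
  note \<kappa>' = measurable_prob_algebraD[OF \<kappa>]
  note bind = nn_integral_bind[OF _ \<kappa>']
  let ?m = "\<lambda>y :: real^'q. ennreal (ln (1 + (norm y)\<^sup>2))"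
  have m: "?m \<in> borel_measurable borel" by measurable
  have "(\<lambda>\<theta>. \<integral>\<^sup>+y. ?m y \<partial>\<kappa> \<theta>) \<in> borel_measurable \<pi>"
    by (rule measurable_compose[OF \<kappa>' nn_integral_measurable_subprob_algebra[OF m]])
  \<comment> \<open>The logarithmic moment of the mixture is the average of those of its components,
    so almost all of these are finite.\<close>
  moreover have "(\<integral>\<^sup>+\<theta>. \<integral>\<^sup>+y. ?m y \<partial>\<kappa> \<theta> \<partial>\<pi>) \<noteq> \<infinity>"
    unfolding bind[OF m, symmetric] using \<sigma> by (auto simp: log_moment_laws_iff less_top)
  ultimately have "AE \<theta> in \<pi>. (\<integral>\<^sup>+y. ?m y \<partial>\<kappa> \<theta>) \<noteq> \<infinity>"
    by (rule nn_integral_PInf_AE)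
  then show laws: "AE \<theta> in \<pi>. \<kappa> \<theta> \<in> log_moment_laws"
    using AE_space by eventually_elim (simp add: log_moment_laws_iff prob less_top)

  define \<sigma> where "\<sigma> = \<pi> \<bind> \<kappa>"
  define I where "I \<theta> = mean_log_det c {1..N} (\<lambda>_. \<kappa> \<theta>)" for \<theta>
  define I\<^sub>\<sigma> where "I\<^sub>\<sigma> = mean_log_det c {1..N} (\<lambda>_. \<sigma>)"
  have \<sigma>: "\<sigma> \<in> log_moment_laws" using \<sigma> by (simp add: \<sigma>_def)
  have fin: "I\<^sub>\<sigma> < \<infinity>"
    unfolding I\<^sub>\<sigma>_def using c \<sigma> by (intro mean_log_det_finite) auto
  have I[measurable]: "I \<in> borel_measurable \<pi>"
    unfolding I_def mean_log_det_def
  proof (rule measurable_nn_integral_PiM_kernel[OF \<kappa>])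
    have "(\<lambda>x. ennreal (log_det c {1..N} (snd x))) \<in>
        borel_measurable (\<pi> \<Otimes>\<^sub>M PiM {1..N} (\<lambda>_. borel :: (real^'q) measure))"
      by (intro measurable_compose[OF measurable_compose[OF measurable_snd measurable_log_det] measurable_ennreal]) simp
    then show "(\<lambda>(\<theta>, ys). ennreal (log_det c {1..N} ys)) \<in>
        borel_measurable (\<pi> \<Otimes>\<^sub>M PiM {1..N} (\<lambda>_. borel :: (real^'q) measure))"
      by (simp add: case_prod_unfold)
  qed simp

  obtain h :: "real^'q \<Rightarrow> ennreal" where h: "h \<in> borel_measurable borel"
    and slot: "\<And>\<mu>. prob_space \<mu> \<Longrightarrow> sets \<mu> = sets borel \<Longrightarrow>
      mean_log_det c {1..N} ((\<lambda>_. \<sigma>)(1 := \<mu>)) = (\<integral>\<^sup>+y. h y \<partial>\<mu>)"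
    using mean_log_det_slot[of "{1..N}" 1 \<sigma> c] N log_moment_lawsD(1,2)[OF \<sigma>] by auto
  have tangent: "AE \<theta> in \<pi>. I \<theta> + of_nat (N - 1) * I\<^sub>\<sigma> \<le> of_nat N * (\<integral>\<^sup>+y. h y \<partial>\<kappa> \<theta>)"
    using laws AE_space
  proof eventually_elim
    case (elim \<theta>)
    show ?case
      using mean_log_det_tangent[OF c N elim(1) \<sigma>] unfolding slot[OF prob[OF elim(2)]] I_def I\<^sub>\<sigma>_def .
  qed
  have "(\<integral>\<^sup>+\<theta>. I \<theta> \<partial>\<pi>) + of_nat (N - 1) * I\<^sub>\<sigma> = (\<integral>\<^sup>+\<theta>. I \<theta> + of_nat (N - 1) * I\<^sub>\<sigma> \<partial>\<pi>)"
    by (simp add: nn_integral_add \<pi>.emeasure_space_1)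
  also have "\<dots> \<le> (\<integral>\<^sup>+\<theta>. of_nat N * (\<integral>\<^sup>+y. h y \<partial>\<kappa> \<theta>) \<partial>\<pi>)"
    by (rule nn_integral_mono_AE[OF tangent])
  also have "\<dots> = of_nat N * (\<integral>\<^sup>+\<theta>. \<integral>\<^sup>+y. h y \<partial>\<kappa> \<theta> \<partial>\<pi>)"
    by (rule nn_integral_cmult) (rule measurable_compose[OF \<kappa>' nn_integral_measurable_subprob_algebra[OF h]])
  also have "(\<integral>\<^sup>+\<theta>. \<integral>\<^sup>+y. h y \<partial>\<kappa> \<theta> \<partial>\<pi>) = (\<integral>\<^sup>+y. h y \<partial>\<sigma>)"
    unfolding \<sigma>_def by (rule bind[OF h, symmetric])
  \<comment> \<open>Putting \<sigma> into the slot where all others already hold \<sigma> changes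
    nothing.\<close>
  also have "\<dots> = I\<^sub>\<sigma>"
    unfolding I\<^sub>\<sigma>_def slot[OF log_moment_lawsD(1,2)[OF \<sigma>], symmetric] by (rule mean_log_det_cong) simp
  also have "of_nat N * I\<^sub>\<sigma> = I\<^sub>\<sigma> + of_nat (N - 1) * I\<^sub>\<sigma>"
    using N by (cases N) (simp_all add: distrib_right)
  \<comment> \<open>Cancelling \<open>of_nat (N - 1) * I\<^sub>\<sigma>\<close> in
    \<open>ennreal\<close> is legitimate because \<open>I\<^sub>\<sigma>\<close> is finite.\<close>
  finally have le: "(\<integral>\<^sup>+\<theta>. I \<theta> \<partial>\<pi>) \<le> I\<^sub>\<sigma>"
    using fin by (auto simp: add.commute[of _ "of_nat (N - 1) * I\<^sub>\<sigma>"] ennreal_add_left_cancel_le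
        ennreal_mult_eq_top_iff)
  have fin': "(\<integral>\<^sup>+\<theta>. I \<theta> \<partial>\<pi>) < \<infinity>"
    using le fin by (rule order_le_less_trans)
  \<comment> \<open>\<open>enn2real\<close> sends infinity to 0, so infinite values have to be
    confined to a null set before passing to reals.\<close>
  then have "AE \<theta> in \<pi>. I \<theta> \<noteq> \<infinity>"
    by (intro nn_integral_PInf_AE I) auto
  then have real: "(\<integral>\<^sup>+\<theta>. ennreal (enn2real (I \<theta>)) \<partial>\<pi>) = (\<integral>\<^sup>+\<theta>. I \<theta> \<partial>\<pi>)"
    by (intro nn_integral_cong_AE, eventually_elim) (simp add: less_top)
  have int: "integrable \<pi> (\<lambda>\<theta>. enn2real (I \<theta>))"
    using real fin' by (intro integrableI_nonneg) auto
  have F\<kappa>: "F N t (\<kappa> \<theta>) = 1 / real CARD('q) * enn2real (I \<theta>)" if "\<theta> \<in> space \<pi>" for \<theta>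
    using F_eq_mean_log_det[OF prob(2)[OF that]] by (simp add: I_def c_def)
  have "integrable \<pi> (\<lambda>\<theta>. 1 / real CARD('q) * enn2real (I \<theta>))"
    using int by (rule integrable_mult_right)
  then show "integrable \<pi> (\<lambda>\<theta>. F N t (\<kappa> \<theta>))"
    by (subst Bochner_Integration.integrable_cong[OF refl F\<kappa>])
  have "(\<integral>\<theta>. F N t (\<kappa> \<theta>) \<partial>\<pi>) = (\<integral>\<theta>. 1 / real CARD('q) * enn2real (I \<theta>) \<partial>\<pi>)"
    by (rule Bochner_Integration.integral_cong[OF refl F\<kappa>])
  also have "\<dots> = 1 / real CARD('q) * (\<integral>\<theta>. enn2real (I \<theta>) \<partial>\<pi>)"
    by (rule integral_mult_right_zero)
  also have "(\<integral>\<theta>. enn2real (I \<theta>) \<partial>\<pi>) = enn2real (\<integral>\<^sup>+\<theta>. I \<theta> \<partial>\<pi>)"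
    using real by (subst integral_eq_nn_integral) auto
  also have "1 / real CARD('q) * \<dots> \<le> 1 / real CARD('q) * enn2real I\<^sub>\<sigma>"
    using le fin by (intro mult_left_mono enn2real_mono) auto
  also have "\<dots> = F N t \<sigma>"
    using F_eq_mean_log_det[OF log_moment_lawsD(2)[OF \<sigma>]] by (simp add: I\<^sub>\<sigma>_def c_def)
  finally show "F N t (\<pi> \<bind> \<kappa>) \<ge> (\<integral>\<theta>. F N t (\<kappa> \<theta>) \<partial>\<pi>)"
    by (simp add: \<sigma>_def)
qed

end

section \<open>Convex combinations and orthogonal averages as mixtures\<close>

lemma bind_in_log_moment_laws:
  assumes \<pi>: "prob_space \<pi>" and \<kappa>: "\<kappa> \<in> \<pi> \<rightarrow>\<^sub>M prob_algebra borel"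
    and fin: "(\<integral>\<^sup>+\<theta>. \<integral>\<^sup>+y. ennreal (ln (1 + (norm y)\<^sup>2)) \<partial>\<kappa> \<theta> \<partial>\<pi>) < \<infinity>"
  shows "\<pi> \<bind> \<kappa> \<in> log_moment_laws"
proof -
  have \<pi>': "\<pi> \<in> space (prob_algebra \<pi>)"
    using \<pi> by (simp add: space_prob_algebra)
  have "(\<integral>\<^sup>+y. ennreal (ln (1 + (norm y)\<^sup>2)) \<partial>(\<pi> \<bind> \<kappa>)) < \<infinity>"
    using fin by (subst nn_integral_bind[OF _ measurable_prob_algebraD[OF \<kappa>]]) auto
  then show ?thesis
    using prob_space_bind'[OF \<pi>' \<kappa>] sets_bind'[OF \<pi>' \<kappa>] by (simp add: log_moment_laws_iff)
qed

text \<open>A coin that shows \<open>True\<close> with probability \<open>u\<close> selects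
  \<open>\<sigma>\<^sub>1\<close>, otherwise \<open>\<sigma>\<^sub>0\<close>.\<close>

lemma mix_law_eq_bind:
  assumes u: "0 \<le> u" "u \<le> 1" and \<sigma>: "\<sigma>\<^sub>0 \<in> space (prob_algebra M)" "\<sigma>\<^sub>1 \<in> space (prob_algebra M)"
  shows "mix_law u \<sigma>\<^sub>0 \<sigma>\<^sub>1 = measure_pmf (bernoulli_pmf u) \<bind> (\<lambda>b. if b then \<sigma>\<^sub>1 else \<sigma>\<^sub>0)"
proof -
  let ?B = "measure_pmf (bernoulli_pmf u)" and ?\<kappa> = "\<lambda>b. if b then \<sigma>\<^sub>1 else \<sigma>\<^sub>0"
  have \<kappa>: "?\<kappa> \<in> ?B \<rightarrow>\<^sub>M prob_algebra M"
    using \<sigma> by simp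
  have B: "?B \<in> space (prob_algebra ?B)"
    by (simp add: space_prob_algebra measure_pmf.prob_space_axioms)
  have sets: "sets \<sigma>\<^sub>0 = sets M" "sets \<sigma>\<^sub>1 = sets M"
    using \<sigma> by (auto simp: space_prob_algebra)
  show ?thesis
  proof (rule measure_eqI)
    show "sets (mix_law u \<sigma>\<^sub>0 \<sigma>\<^sub>1) = sets (?B \<bind> ?\<kappa>)"
      using sets_bind'[OF B \<kappa>] sets by simp
    fix A assume "A \<in> sets (mix_law u \<sigma>\<^sub>0 \<sigma>\<^sub>1)"
    then have A: "A \<in> sets M" using sets by simp
    have "emeasure (mix_law u \<sigma>\<^sub>0 \<sigma>\<^sub>1) A = ennreal (1 - u) * emeasure \<sigma>\<^sub>0 A + ennreal u * emeasure \<sigma>\<^sub>1 A"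
      using A sets by (intro emeasure_mix_law) auto
    also have "\<dots> = (\<integral>\<^sup>+b. emeasure (?\<kappa> b) A \<partial>?B)"
      using u by (simp add: mult.commute add.commute)
    also have "\<dots> = emeasure (?B \<bind> ?\<kappa>) A"
      using emeasure_bind_prob_algebra[OF B \<kappa> A] by simp
    finally show "emeasure (mix_law u \<sigma>\<^sub>0 \<sigma>\<^sub>1) A = emeasure (?B \<bind> ?\<kappa>) A" .
  qed
qed

text \<open>Independent samples from the rotated law are the rotated samples from \<sigma>, and a
  common rotation does not change the determinant.\<close>

lemma F_orthogonal:
  fixes Q :: "real^'q^'q"
  assumes Q: "orthogonal_matrix Q" and \<sigma>: "prob_space \<sigma>" "sets \<sigma> = sets borel"
  shows "F N t (distr \<sigma> borel (\<lambda>y. Q *v y)) = F N t \<sigma>"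
proof -
  have Qb: "(\<lambda>y. Q *v y) \<in> borel \<rightarrow>\<^sub>M borel"
    by (intro borel_measurable_continuous_onI matrix_vector_mult_linear_continuous_on)
  have Qm: "(\<lambda>y. Q *v y) \<in> \<sigma> \<rightarrow>\<^sub>M \<sigma>"
    unfolding measurable_cong_sets[OF \<sigma>(2) \<sigma>(2)] by (rule Qb)
  \<comment> \<open>\<open>distr\<close> depends on its target only through the measurable space, so
    the coordinatewise map can be viewed as acting on \<open>iid_law N \<sigma>\<close>
    itself.\<close>
  have "distr \<sigma> borel (\<lambda>y. Q *v y) = distr \<sigma> \<sigma> (\<lambda>y. Q *v y)"
    using \<sigma> by (intro distr_cong) auto
  then have "iid_law N (distr \<sigma> borel (\<lambda>y. Q *v y)) = distr (iid_law N \<sigma>) (iid_law N \<sigma>) (compose {1..N} (\<lambda>y. Q *v y))"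
    using \<sigma> Qm by (simp add: distr_PiM_finite_prob_space')
  moreover have "compose {1..N} (\<lambda>y. Q *v y) \<in> iid_law N \<sigma> \<rightarrow>\<^sub>M iid_law N \<sigma>"
    unfolding compose_def
  proof (rule measurable_restrict)
    fix i assume "i \<in> {1..N}"
    then show "(\<lambda>ys. Q *v ys i) \<in> iid_law N \<sigma> \<rightarrow>\<^sub>M \<sigma>"
      using measurable_compose[of "\<lambda>ys. ys i" "iid_law N \<sigma>" \<sigma>, OF _ Qm]
        measurable_component_singleton[of i "{1..N}" "\<lambda>_. \<sigma>"] by blast
  qed
  moreover have "log_det_sample N t \<in> borel_measurable (iid_law N \<sigma>)"
    by (rule measurable_log_det_sample[OF \<sigma>(2)])
  ultimately have "(\<integral>ys. log_det_sample N t ys \<partial>iid_law N (distr \<sigma> borel (\<lambda>y. Q *v y))) =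
      (\<integral>ys. log_det_sample N t (compose {1..N} (\<lambda>y. Q *v y) ys) \<partial>iid_law N \<sigma>)"
    by (simp add: integral_distr)
  also have "\<dots> = (\<integral>ys. log_det_sample N t ys \<partial>iid_law N \<sigma>)"
  proof (rule Bochner_Integration.integral_cong[OF refl])
    fix ys :: "nat \<Rightarrow> real^'q"
    have "info_matrix c {1..N} (compose {1..N} (\<lambda>y. Q *v y) ys) = info_matrix c {1..N} (\<lambda>j. Q *v ys j)" for c
      by (rule info_matrix_cong) (simp add: compose_def)
    then show "log_det_sample N t (compose {1..N} (\<lambda>y. Q *v y) ys) = log_det_sample N t ys"
      by (simp only: log_det_sample_eq det_info_matrix_orthogonal[OF Q])
  qed
  finally show ?thesis by (simp add: F_def)
qed

lemma mix_law_log_moment: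
  assumes u: "u \<in> {0..1}" and \<sigma>: "\<sigma>\<^sub>0 \<in> log_moment_laws" "\<sigma>\<^sub>1 \<in> log_moment_laws"
  shows "mix_law u \<sigma>\<^sub>0 \<sigma>\<^sub>1 \<in> log_moment_laws"
proof -
  have "\<sigma>\<^sub>0 \<in> space (prob_algebra borel)" "\<sigma>\<^sub>1 \<in> space (prob_algebra borel)"
    using \<sigma> by (auto simp: log_moment_laws_def)
  moreover from this u \<sigma> have "measure_pmf (bernoulli_pmf u) \<bind> (\<lambda>b. if b then \<sigma>\<^sub>1 else \<sigma>\<^sub>0) \<in> log_moment_laws"
    by (intro bind_in_log_moment_laws)
       (auto simp: measure_pmf.prob_space_axioms log_moment_laws_iff ennreal_mult_less_top ennreal_mult_eq_top_iff less_top)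
  ultimately show ?thesis
    using u by (simp add: mix_law_eq_bind)
qed

lemma F_mix_law:
  assumes N: "N \<ge> 1" and t: "t > 0" and u: "u \<in> {0..1}"
    and \<sigma>: "\<sigma>\<^sub>0 \<in> log_moment_laws" "\<sigma>\<^sub>1 \<in> log_moment_laws"
  shows "F N t (mix_law u \<sigma>\<^sub>0 \<sigma>\<^sub>1) \<ge> (1 - u) * F N t \<sigma>\<^sub>0 + u * F N t \<sigma>\<^sub>1"
proof -
  let ?\<kappa> = "\<lambda>b. if b then \<sigma>\<^sub>1 else \<sigma>\<^sub>0"
  have sp: "\<sigma>\<^sub>0 \<in> space (prob_algebra borel)" "\<sigma>\<^sub>1 \<in> space (prob_algebra borel)"
    using \<sigma> by (auto simp: log_moment_laws_def)
  have mix: "mix_law u \<sigma>\<^sub>0 \<sigma>\<^sub>1 = measure_pmf (bernoulli_pmf u) \<bind> ?\<kappa>"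
    using u sp by (intro mix_law_eq_bind) auto
  have "(\<integral>b. F N t (?\<kappa> b) \<partial>measure_pmf (bernoulli_pmf u)) \<le> F N t (measure_pmf (bernoulli_pmf u) \<bind> ?\<kappa>)"
    using mix_law_log_moment[OF u \<sigma>] sp unfolding mix
    by (intro F_mixture[OF N t]) (auto simp: measure_pmf.prob_space_axioms)
  then show ?thesis
    using u by (simp add: mix algebra_simps)
qed

lemma measurable_matrix_vector_mult:
  "(\<lambda>(Q :: real^'q^'q, y). Q *v y) \<in> borel \<Otimes>\<^sub>M borel \<rightarrow>\<^sub>M borel"
proof -
  have "continuous_on UNIV (\<lambda>p :: (real^'q^'q) \<times> (real^'q). fst p *v snd p)"
    unfolding matrix_vector_mult_def by (intro continuous_intros)
  then show ?thesis
    by (simp add: borel_prod case_prod_unfold borel_measurable_continuous_onI)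
qed

lemma haar_orthogonalD:
  assumes "haar_orthogonal H"
  shows "prob_space H" "sets H = sets (restrict_space borel {Q. orthogonal_matrix Q})"
    "\<And>Q. Q \<in> space H \<Longrightarrow> orthogonal_matrix Q"
proof -
  show "prob_space H" and sets: "sets H = sets (restrict_space borel {Q. orthogonal_matrix Q})"
    using assms by (auto simp: haar_orthogonal_def space_prob_algebra)
  show "orthogonal_matrix Q" if "Q \<in> space H" for Q
    using that sets_eq_imp_space_eq[OF sets] by (simp add: space_restrict_space)
qed

text \<open>Given the matrix \<open>Q\<close>, the vector \<open>Q *v y\<close> has the image law of
  \<sigma> under \<open>Q\<close>. By Fubini, the independent rotation is the mixture of these image
  laws over \<open>H\<close>.\<close>

lemma rotation_kernel:
  fixes H :: "(real^'q^'q) measure"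
  assumes H: "haar_orthogonal H" and \<sigma>: "prob_space \<sigma>" "sets \<sigma> = sets borel"
  shows "(\<lambda>Q. distr \<sigma> borel (\<lambda>y. Q *v y)) \<in> H \<rightarrow>\<^sub>M prob_algebra borel"
    and "rotated_law H \<sigma> = H \<bind> (\<lambda>Q. distr \<sigma> borel (\<lambda>y. Q *v y))"
proof -
  note H = haar_orthogonalD[OF H]
  interpret \<sigma>: prob_space \<sigma> by (rule \<sigma>)
  let ?\<kappa> = "\<lambda>Q. distr \<sigma> borel (\<lambda>y. Q *v y)"
  \<comment> \<open>\<open>H\<close> lives on the subspace of orthogonal matrices, so the inclusion
    into all matrices has to be measurable before multiplication can be composed with it.\<close>
  have id: "(\<lambda>Q. Q) \<in> H \<rightarrow>\<^sub>M borel"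
    using measurable_restrict_space1[OF measurable_ident_sets[OF refl], of borel]
    by (simp add: measurable_cong_sets[OF H(2) refl])
  have "(\<lambda>x. (fst x, snd x)) \<in> H \<Otimes>\<^sub>M \<sigma> \<rightarrow>\<^sub>M borel \<Otimes>\<^sub>M borel"
    by (intro measurable_Pair measurable_compose[OF measurable_fst id]
        measurable_compose[OF measurable_snd measurable_ident_sets[OF \<sigma>(2)]])
  from measurable_compose[OF this measurable_matrix_vector_mult]
  have mult: "(\<lambda>(Q, y). Q *v y) \<in> H \<Otimes>\<^sub>M \<sigma> \<rightarrow>\<^sub>M borel"
    by (simp add: case_prod_unfold)
  have Qm: "(\<lambda>y. Q *v y) \<in> \<sigma> \<rightarrow>\<^sub>M borel" for Q :: "real^'q^'q"
    unfolding measurable_cong_sets[OF \<sigma>(2) refl]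
    by (intro borel_measurable_continuous_onI matrix_vector_mult_linear_continuous_on)
  show \<kappa>: "?\<kappa> \<in> H \<rightarrow>\<^sub>M prob_algebra borel"
    by (rule measurable_distr_prob_space2[OF measurable_const mult])
       (use \<sigma> in \<open>simp add: space_prob_algebra\<close>)
  have H': "H \<in> space (prob_algebra H)"
    using H(1) by (simp add: space_prob_algebra)
  show "rotated_law H \<sigma> = H \<bind> ?\<kappa>"
  proof (rule measure_eqI)
    show "sets (rotated_law H \<sigma>) = sets (H \<bind> ?\<kappa>)"
      using sets_bind'[OF H' \<kappa>] by (simp add: rotated_law_def)
    fix A assume "A \<in> sets (rotated_law H \<sigma>)"
    then have A: "A \<in> sets borel" by (simp add: rotated_law_def)
    have "emeasure (rotated_law H \<sigma>) A = (\<integral>\<^sup>+y. indicator A y \<partial>rotated_law H \<sigma>)"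
      using A by (simp add: rotated_law_def)
    also have "\<dots> = (\<integral>\<^sup>+x. indicator A (case x of (Q, y) \<Rightarrow> Q *v y) \<partial>(H \<Otimes>\<^sub>M \<sigma>))"
      unfolding rotated_law_def using A by (intro nn_integral_distr[OF mult]) simp
    also have "\<dots> = (\<integral>\<^sup>+Q. \<integral>\<^sup>+y. indicator A (Q *v y) \<partial>\<sigma> \<partial>H)"
      using measurable_compose[OF mult borel_measurable_indicator[OF A]]
      by (subst \<sigma>.nn_integral_fst[symmetric]) auto
    also have "\<dots> = (\<integral>\<^sup>+Q. emeasure (?\<kappa> Q) A \<partial>H)"
    proof (rule nn_integral_cong)
      fix Q
      have "emeasure (?\<kappa> Q) A = (\<integral>\<^sup>+y. indicator A y \<partial>?\<kappa> Q)"
        using A by simp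
      also have "\<dots> = (\<integral>\<^sup>+y. indicator A (Q *v y) \<partial>\<sigma>)"
        using A Qm by (intro nn_integral_distr) auto
      finally show "(\<integral>\<^sup>+y. indicator A (Q *v y) \<partial>\<sigma>) = emeasure (?\<kappa> Q) A" ..
    qed
    also have "\<dots> = emeasure (H \<bind> ?\<kappa>) A"
      using emeasure_bind_prob_algebra[OF H' \<kappa> A] by simp
    finally show "emeasure (rotated_law H \<sigma>) A = emeasure (H \<bind> ?\<kappa>) A" .
  qed
qed

text \<open>Orthogonal maps preserve the norm, so every component of the mixture has the logarithmic
  moment of \<sigma>.\<close>

lemma rotated_law_log_moment:
  fixes H :: "(real^'q^'q) measure"
  assumes H: "haar_orthogonal H" and \<sigma>: "\<sigma> \<in> log_moment_laws"
  shows "rotated_law H \<sigma> \<in> log_moment_laws"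
proof -
  note \<sigma>' = log_moment_lawsD[OF \<sigma>]
  note H' = haar_orthogonalD[OF H]
  interpret H: prob_space H by (rule H')
  note \<kappa> = rotation_kernel[OF H \<sigma>'(1,2)]
  have Qm: "(\<lambda>y. Q *v y) \<in> \<sigma> \<rightarrow>\<^sub>M borel" for Q :: "real^'q^'q"
    unfolding measurable_cong_sets[OF \<sigma>'(2) refl]
    by (intro borel_measurable_continuous_onI matrix_vector_mult_linear_continuous_on)
  have "(\<integral>\<^sup>+Q. \<integral>\<^sup>+y. ennreal (ln (1 + (norm y)\<^sup>2)) \<partial>distr \<sigma> borel (\<lambda>y. Q *v y) \<partial>H) =
      (\<integral>\<^sup>+Q. \<integral>\<^sup>+y. ennreal (ln (1 + (norm y)\<^sup>2)) \<partial>\<sigma> \<partial>H)"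
    by (rule nn_integral_cong)
       (simp add: nn_integral_distr[OF Qm] norm_orthogonal_matrix_mult[OF H'(3)])
  also have "\<dots> < \<infinity>"
    using \<sigma> by (simp add: H.emeasure_space_1 log_moment_laws_iff)
  finally show ?thesis
    unfolding \<kappa>(2) by (rule bind_in_log_moment_laws[OF H'(1) \<kappa>(1)])
qed

text \<open>By \<open>F_orthogonal\<close> all components of the mixture share the value
  \<open>F N t \<sigma>\<close>, which is therefore also their average; concavity compares it with
  the value at the mixture.\<close>

lemma F_rotated_law:
  fixes H :: "(real^'q^'q) measure"
  assumes N: "N \<ge> 1" and t: "t > 0" and H: "haar_orthogonal H" and \<sigma>: "\<sigma> \<in> log_moment_laws"
  shows "F N t \<sigma> \<le> F N t (rotated_law H \<sigma>)"
proof -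
  note \<sigma>' = log_moment_lawsD[OF \<sigma>]
  note H' = haar_orthogonalD[OF H]
  interpret H: prob_space H by (rule H')
  note \<kappa> = rotation_kernel[OF H \<sigma>'(1,2)]
  have "F N t \<sigma> = (\<integral>Q. F N t (distr \<sigma> borel (\<lambda>y. Q *v y)) \<partial>H)"
  proof -
    have "(\<integral>Q. F N t (distr \<sigma> borel (\<lambda>y. Q *v y)) \<partial>H) = (\<integral>Q. F N t \<sigma> \<partial>H)"
      by (intro Bochner_Integration.integral_cong refl F_orthogonal H'(3) \<sigma>'(1,2))
    then show ?thesis by (simp add: H.prob_space)
  qed
  also have "\<dots> \<le> F N t (rotated_law H \<sigma>)"
    unfolding \<kappa>(2)
    by (rule F_mixture(3)[OF N t H'(1) \<kappa>(1)])
       (use rotated_law_log_moment[OF H \<sigma>] in \<open>simp add: \<kappa>(2)\<close>)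
  finally show ?thesis .
qed

theorem lemma6p1:
  fixes N :: nat and t :: real
  assumes "N \<ge> 1" and "t > 0"
  shows
    "(\<forall>\<sigma> :: (real^'q) measure. \<sigma> \<in> log_moment_laws \<longrightarrow>
        integrable (iid_law N \<sigma>) (log_det_sample N t)) \<and>
     (\<forall>(\<sigma>\<^sub>0 :: (real^'q) measure) \<sigma>\<^sub>1. \<forall>u\<in>{0..1}.
        \<sigma>\<^sub>0 \<in> log_moment_laws \<longrightarrow> \<sigma>\<^sub>1 \<in> log_moment_laws \<longrightarrow>
        mix_law u \<sigma>\<^sub>0 \<sigma>\<^sub>1 \<in> log_moment_laws \<and>
        F N t (mix_law u \<sigma>\<^sub>0 \<sigma>\<^sub>1) \<ge> (1 - u) * F N t \<sigma>\<^sub>0 + u * F N t \<sigma>\<^sub>1) \<and>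
     (\<forall>(\<sigma> :: (real^'q) measure) H.
        \<sigma> \<in> log_moment_laws \<longrightarrow> haar_orthogonal H \<longrightarrow>
        rotated_law H \<sigma> \<in> log_moment_laws \<and> F N t \<sigma> \<le> F N t (rotated_law H \<sigma>)) \<and>
     (\<forall>(\<pi> :: 'b measure) (\<kappa> :: 'b \<Rightarrow> (real^'q) measure).
        prob_space \<pi> \<longrightarrow> \<kappa> \<in> \<pi> \<rightarrow>\<^sub>M prob_algebra borel \<longrightarrow>
        (\<pi> \<bind> \<kappa>) \<in> log_moment_laws \<longrightarrow>
        (AE \<theta> in \<pi>. \<kappa> \<theta> \<in> log_moment_laws) \<and>
        integrable \<pi> (\<lambda>\<theta>. F N t (\<kappa> \<theta>)) \<and>
        F N t (\<pi> \<bind> \<kappa>) \<ge> (\<integral>\<theta>. F N t (\<kappa> \<theta>) \<partial>\<pi>))"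
  by (intro conjI allI ballI impI integrable_log_det_sample[OF assms] mix_law_log_moment
      F_mix_law[OF assms] rotated_law_log_moment F_rotated_law[OF assms] F_mixture[OF assms])
    assumption+

end
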